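(* Equip $\mathbb{Z}^n$ with the standard $L^1$-norm $\|v\|=\sum_i|v_i|$. (a) For any scaling set $T$, $\hat{\mathcal{C}}(\mathbb{Z}^n,T)$ is isometric to $\mathbb{R}^n$ with the standard $L^1$-norm. (b) $\mathbb{Z}^n$ is independent of scaling and $\rho_{\omega,\mathbf{d}}\colon\hat{\mathcal{C}}(\mathbb{Z}^n)\to\mathrm{Cone}_\omega(\mathbb{Z}^n,\mathbf{d})$, $[g]\mapsto\{g(d_k)\}_k$, is an isometry (for any non-principal ultrafilter $\omega$ on $\mathbb{N}$ and any scaling sequence $\mathbf{d}=(d_k)$).
   Context: Norms. A norm on a group $G$ is a function $\|\cdot\|\colon G\to[0,\infty)$ with $\|g\|=0\iff g=1$, $\|g^{-1}\|=\|g\|$ and $\|gh\|\le\|g\|+\|h\|$; for a pseudonorm one only requires $\|1\|=0$ instead of the first condition. It is conjugation-invariant if $\|hgh^{-1}\|=\|g\|$ for all $g,h$. It induces the bi-invariant (pseudo)metric $d(g,h)=\|g^{-1}h\|$; all metric notions refer to it. The groups $F_{\mathbb{R}}(G)$ and $F(G)$. Let $G$ be a group with a conjugation-invariant norm. $F_{\mathbb{R}}(G)$ is the free product of copies of the additive group $\mathbb{R}$ indexed by the elements $g$ of the set $G$; the element $r$ of the copy indexed by $g$ is written $\overline{g}(r)$. It carries the conjugation-invariant pseudonorm $$\|x\|=\inf\Big\{\sum_{i=1}^n |r_i|\,\|g_i\| : x=\prod_{i=1}^n h_i\,\overline{g_i}(r_i)^{\pm1}h_i^{-1},\ h_i\in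 F_{\mathbb{R}}(G)\Big\}.$$ $F(G)\le F_{\mathbb{R}}(G)$ is the subgroup generated by the elements $\overline{g}:=\overline{g}(1)$; it is free on $\{\overline{g}: g\in G\}$. For $t\in\mathbb{R}$, $\psi_t\colon F_{\mathbb{R}}(G)\to F_{\mathbb{R}}(G)$ is the homomorphism with $\psi_t(\overline{g}(r))=\overline{g}(tr)$. $\pi\colon F(G)\to G$ is the homomorphism with $\pi(\overline{g})=g$. Directional asymptotic cone. A scaling set is an unbounded subset $T\subseteq(0,\infty)$; limits over $t\in T$ are taken as $t\to\infty$. A function $f$ from $T$ to a pseudometric space is Cauchy if for every $\epsilon>0$, $d(f(t),f(t'))<\epsilon$ for all sufficiently large $t,t'\in T$. $\mathcal{D}(G,T)$ is the group (pointwise product) of all functions $w\colon T\to F(G)$ such that $t\mapsto\psi_{1/t}(w(t))\in F_{\mathbb{R}}(G)$ is Cauchy, with pseudonorm $\|w\|=\lim_{t\in T}\|\psi_{1/t}(w(t))\|$. $\mathcal{C}(G,T)=\{\pi\circ w: w\in\mathcal{D}(G,T)\}$, a group of functions $T\to G$, with pseudonorm $\|g\|=\inf\{\|w\|: w\in\mathcal{D}(G,T),\ \pi\circ w=g\}$. The directional asymptotic cone $\hat{\mathcal{C}}(G,T)$ is the quotient of $\mathcal{C}(G,T)$ by the normal subgroup of elements of pseudonorm $0$, with the induced conjugation-invariant norm; $[g]$ denotes the class of $g$. Write $\hat{\mathcal{C}}(G)=\hat{\mathcal{C}}(G,(0,\infty))$. Independence of scaling. For scaling sets $T\subseteq T'$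 there is a well-defined homomorphism $\hat{\mathcal{C}}(G,T')\to\hat{\mathcal{C}}(G,T)$, $[g]\mapsto[g|_T]$. $G$ is independent of scaling if this is an isometry for all scaling sets $T\subseteq T'$. Ultrafilter cone. A scaling sequence is a sequence $\mathbf{d}=(d_k)$ of positive reals with $d_k\to\infty$. For a non-principal ultrafilter $\omega$ on $\mathbb{N}$, $\mathrm{Cone}_\omega(G,\mathbf{d})$ is the group of sequences $(g_k)$ in $G$ with $\limsup_k\|g_k\|/d_k<\infty$ (pointwise product), modulo $(g_k)\sim(h_k)\iff\omega\text{-}\lim_k\|g_k^{-1}h_k\|/d_k=0$, with the norm $\|\{g_k\}\|=\omega\text{-}\lim_k\|g_k\|/d_k$; $\{g_k\}$ denotes the class of $(g_k)$. The map $\rho_{\omega,\mathbf{d}}$ is a well-defined homomorphism. *)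

theory Defs
  imports "HOL-Analysis.Analysis" "HOL-Algebra.Product_Groups"
begin

section \<open>Conjugation-invariant norms\<close>

locale conj_inv_normed_group = group G for G (structure) +
  fixes N :: "'a \<Rightarrow> real"
  assumes norm_nonneg: "x \<in> carrier G \<Longrightarrow> 0 \<le> N x"
    and norm_eq_0_iff: "x \<in> carrier G \<Longrightarrow> N x = 0 \<longleftrightarrow> x = \<one>"
    and norm_inv: "x \<in> carrier G \<Longrightarrow> N (inv x) = N x"
    and norm_mult: "x \<in> carrier G \<Longrightarrow> y \<in> carrier G \<Longrightarrow> N (x \<otimes> y) \<le> N x + N y"
    and norm_conj: "x \<in> carrier G \<Longrightarrow> h \<in> carrier G \<Longrightarrow> N (h \<otimes> x \<otimes> inv h) = N x"

definition group_dist :: "('a, 'b) monoid_scheme \<Rightarrow> ('a \<Rightarrow> real) \<Rightarrow> 'a \<Rightarrow> 'a \<Rightarrow> real" where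
  "group_dist G N x y = N (inv\<^bsub>G\<^esub> x \<otimes>\<^bsub>G\<^esub> y)"

text \<open>Isometries between normed groups are taken to be surjective group homomorphisms.\<close>

definition isometric_iso ::
  "('a, 'c) monoid_scheme \<Rightarrow> ('a \<Rightarrow> real) \<Rightarrow> ('b, 'd) monoid_scheme \<Rightarrow> ('b \<Rightarrow> real) \<Rightarrow> ('a \<Rightarrow> 'b) \<Rightarrow> bool"
where
  "isometric_iso G N H M \<phi> \<longleftrightarrow> \<phi> \<in> iso G H \<and>
     (\<forall>x\<in>carrier G. \<forall>y\<in>carrier G. group_dist H M (\<phi> x) (\<phi> y) = group_dist G N x y)"


section \<open>The free product of copies of the reals\<close>

text \<open>
  Elements of the free product of copies of the additive group of the reals indexed by \<open>S\<close>
  are represented by their normal forms: words of syllables \<open>(g, r)\<close> with \<open>g \<in> S\<close> and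
  \<open>r \<noteq> 0\<close>, consecutive syllables belonging to different copies.
  \<open>fr_cons g r\<close> is left multiplication of a normal form by the element \<open>r\<close> of the copy
  indexed by \<open>g\<close>.
\<close>

definition fr_words :: "'a set \<Rightarrow> ('a \<times> real) list set" where
  "fr_words S = {w. set w \<subseteq> S \<times> (UNIV - {0}) \<and> successively (\<lambda>p q. fst p \<noteq> fst q) w}"

fun fr_cons :: "'a \<Rightarrow> real \<Rightarrow> ('a \<times> real) list \<Rightarrow> ('a \<times> real) list" where
  "fr_cons g r [] = (if r = 0 then [] else [(g, r)])"
| "fr_cons g r ((h, s) # w) =
     (if h = g then (if r + s = 0 then w else (g, r + s) # w)
      else if r = 0 then (h, s) # w else (g, r) # (h, s) # w)"

definition FR :: "'a set \<Rightarrow> ('a \<times> real) list monoid" where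
  "FR S = \<lparr>carrier = fr_words S,
           monoid.mult = (\<lambda>x y. foldr (\<lambda>(g, r). fr_cons g r) x y),
           one = []\<rparr>"

definition fr_gen :: "'a \<Rightarrow> real \<Rightarrow> ('a \<times> real) list" where
  "fr_gen g r = fr_cons g r []"

text \<open>The product in \<open>H\<close> of the elements \<open>f g r\<close> over the syllables \<open>(g, r)\<close> of a word.\<close>

definition fr_fold :: "('b, 'c) monoid_scheme \<Rightarrow> ('a \<Rightarrow> real \<Rightarrow> 'b) \<Rightarrow> ('a \<times> real) list \<Rightarrow> 'b" where
  "fr_fold H f x = foldr (\<lambda>(g, r) y. f g r \<otimes>\<^bsub>H\<^esub> y) x \<one>\<^bsub>H\<^esub>"

definition fr_scale :: "'a set \<Rightarrow> real \<Rightarrow> ('a \<times> real) list \<Rightarrow> ('a \<times> real) list" where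
  "fr_scale S t = fr_fold (FR S) (\<lambda>g r. fr_gen g (t * r))"

definition FG :: "'a set \<Rightarrow> ('a \<times> real) list monoid" where
  "FG S = subgroup_generated (FR S) ((\<lambda>g. fr_gen g 1) ` S)"

text \<open>
  All exponents \<open>r\<close> occurring in elements of \<open>FG (carrier G)\<close> are integers, so the floor
  below merely converts the type; see \<open>fg_eval_hom\<close> and \<open>fg_eval_gen\<close>.
\<close>

definition fg_eval :: "('a, 'b) monoid_scheme \<Rightarrow> ('a \<times> real) list \<Rightarrow> 'a" where
  "fg_eval G = fr_fold G (\<lambda>g r. g [^]\<^bsub>G\<^esub> \<lfloor>r\<rfloor>)"

text \<open>
  A list entry \<open>(h, g, r, e)\<close> stands for the factor \<open>h (fr_gen g r)\<^sup>e h\<^sup>-\<^sup>1\<close>, where \<open>e\<close> is \<open>1\<close> or \<open>- 1\<close>.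
\<close>

definition fr_norm :: "('a, 'b) monoid_scheme \<Rightarrow> ('a \<Rightarrow> real) \<Rightarrow> ('a \<times> real) list \<Rightarrow> real" where
  "fr_norm G N x = (let F = FR (carrier G) in
     Inf {(\<Sum>(h, g, r, e)\<leftarrow>ps. \<bar>r\<bar> * N g) | ps.
            set ps \<subseteq> carrier F \<times> carrier G \<times> (UNIV :: real set) \<times> {1, - 1 :: int} \<and>
            x = foldr (\<lambda>(h, g, r, e) y. (h \<otimes>\<^bsub>F\<^esub> fr_gen g r [^]\<^bsub>F\<^esub> e \<otimes>\<^bsub>F\<^esub> inv\<^bsub>F\<^esub> h) \<otimes>\<^bsub>F\<^esub> y) ps \<one>\<^bsub>F\<^esub>})"


section \<open>The directional asymptotic cone\<close>

definition scaling_set :: "real set \<Rightarrow> bool" where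
  "scaling_set T \<longleftrightarrow> T \<subseteq> {0<..} \<and> \<not> bounded T"

definition fr_Cauchy ::
  "('a, 'b) monoid_scheme \<Rightarrow> ('a \<Rightarrow> real) \<Rightarrow> real set \<Rightarrow> (real \<Rightarrow> ('a \<times> real) list) \<Rightarrow> bool"
where
  "fr_Cauchy G N T f \<longleftrightarrow>
     (\<forall>\<epsilon>>0. \<exists>t0. \<forall>t\<in>T. \<forall>t'\<in>T. t0 \<le> t \<longrightarrow> t0 \<le> t' \<longrightarrow>
        group_dist (FR (carrier G)) (fr_norm G N) (f t) (f t') < \<epsilon>)"

definition DG :: "('a, 'b) monoid_scheme \<Rightarrow> ('a \<Rightarrow> real) \<Rightarrow> real set \<Rightarrow> (real \<Rightarrow> ('a \<times> real) list) monoid"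
where
  "DG G N T = (product_group T (\<lambda>_. FG (carrier G)))
     \<lparr>carrier := {w \<in> T \<rightarrow>\<^sub>E carrier (FG (carrier G)).
                    fr_Cauchy G N T (\<lambda>t. fr_scale (carrier G) (1 / t) (w t))}\<rparr>"

definition DG_norm ::
  "('a, 'b) monoid_scheme \<Rightarrow> ('a \<Rightarrow> real) \<Rightarrow> real set \<Rightarrow> (real \<Rightarrow> ('a \<times> real) list) \<Rightarrow> real"
where
  "DG_norm G N T w =
     Lim (inf at_top (principal T)) (\<lambda>t. fr_norm G N (fr_scale (carrier G) (1 / t) (w t)))"

definition CG :: "('a, 'b) monoid_scheme \<Rightarrow> ('a \<Rightarrow> real) \<Rightarrow> real set \<Rightarrow> (real \<Rightarrow> 'a) monoid" where
  "CG G N T = (product_group T (\<lambda>_. G))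
     \<lparr>carrier := {compose T (fg_eval G) w | w. w \<in> carrier (DG G N T)}\<rparr>"

definition CG_norm :: "('a, 'b) monoid_scheme \<Rightarrow> ('a \<Rightarrow> real) \<Rightarrow> real set \<Rightarrow> (real \<Rightarrow> 'a) \<Rightarrow> real" where
  "CG_norm G N T g =
     Inf {DG_norm G N T w | w. w \<in> carrier (DG G N T) \<and> compose T (fg_eval G) w = g}"

definition dir_cone_null :: "('a, 'b) monoid_scheme \<Rightarrow> ('a \<Rightarrow> real) \<Rightarrow> real set \<Rightarrow> (real \<Rightarrow> 'a) set" where
  "dir_cone_null G N T = {g \<in> carrier (CG G N T). CG_norm G N T g = 0}"

definition dir_cone :: "('a, 'b) monoid_scheme \<Rightarrow> ('a \<Rightarrow> real) \<Rightarrow> real set \<Rightarrow> (real \<Rightarrow> 'a) set monoid" where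
  "dir_cone G N T = CG G N T Mod dir_cone_null G N T"

definition dir_cone_class ::
  "('a, 'b) monoid_scheme \<Rightarrow> ('a \<Rightarrow> real) \<Rightarrow> real set \<Rightarrow> (real \<Rightarrow> 'a) \<Rightarrow> (real \<Rightarrow> 'a) set"
where
  "dir_cone_class G N T g = dir_cone_null G N T #>\<^bsub>CG G N T\<^esub> g"

text \<open>
  As in the quotient maps of \<^theory>\<open>HOL-Algebra.Coset\<close>, functions induced on a
  quotient are evaluated by applying \<^const>\<open>the_elem\<close> to the set of values at representatives.
\<close>

definition dir_cone_norm :: "('a, 'b) monoid_scheme \<Rightarrow> ('a \<Rightarrow> real) \<Rightarrow> real set \<Rightarrow> (real \<Rightarrow> 'a) set \<Rightarrow> real" where
  "dir_cone_norm G N T X = the_elem (CG_norm G N T ` X)"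

definition dir_cone_restrict ::
  "('a, 'b) monoid_scheme \<Rightarrow> ('a \<Rightarrow> real) \<Rightarrow> real set \<Rightarrow> (real \<Rightarrow> 'a) set \<Rightarrow> (real \<Rightarrow> 'a) set"
where
  "dir_cone_restrict G N T X = the_elem ((\<lambda>g. dir_cone_class G N T (restrict g T)) ` X)"

definition independent_of_scaling :: "('a, 'b) monoid_scheme \<Rightarrow> ('a \<Rightarrow> real) \<Rightarrow> bool" where
  "independent_of_scaling G N \<longleftrightarrow>
     (\<forall>T T'. scaling_set T \<longrightarrow> scaling_set T' \<longrightarrow> T \<subseteq> T' \<longrightarrow>
        isometric_iso (dir_cone G N T') (dir_cone_norm G N T') (dir_cone G N T) (dir_cone_norm G N T)
          (dir_cone_restrict G N T))"


section \<open>The ultrafilter cone\<close>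

definition nonprincipal_ultrafilter :: "nat filter \<Rightarrow> bool" where
  "nonprincipal_ultrafilter \<omega> \<longleftrightarrow> \<omega> \<noteq> bot \<and>
     (\<forall>P. eventually P \<omega> \<or> eventually (\<lambda>k. \<not> P k) \<omega>) \<and> (\<forall>j. \<omega> \<noteq> principal {j})"

definition scaling_sequence :: "(nat \<Rightarrow> real) \<Rightarrow> bool" where
  "scaling_sequence d \<longleftrightarrow> (\<forall>k. 0 < d k) \<and> filterlim d at_top sequentially"

definition ucone_seqs ::
  "('a, 'b) monoid_scheme \<Rightarrow> ('a \<Rightarrow> real) \<Rightarrow> (nat \<Rightarrow> real) \<Rightarrow> (nat \<Rightarrow> 'a) monoid"
where
  "ucone_seqs G N d = (product_group UNIV (\<lambda>_. G))
     \<lparr>carrier := {g. range g \<subseteq> carrier G \<and> limsup (\<lambda>k. ereal (N (g k) / d k)) < \<infinity>}\<rparr>"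

definition ucone_rel ::
  "('a, 'b) monoid_scheme \<Rightarrow> ('a \<Rightarrow> real) \<Rightarrow> nat filter \<Rightarrow> (nat \<Rightarrow> real) \<Rightarrow> ((nat \<Rightarrow> 'a) \<times> (nat \<Rightarrow> 'a)) set"
where
  "ucone_rel G N \<omega> d = {(g, h). g \<in> carrier (ucone_seqs G N d) \<and> h \<in> carrier (ucone_seqs G N d) \<and>
     ((\<lambda>k. N (inv\<^bsub>G\<^esub> (g k) \<otimes>\<^bsub>G\<^esub> h k) / d k) \<longlongrightarrow> 0) \<omega>}"

definition ucone_class ::
  "('a, 'b) monoid_scheme \<Rightarrow> ('a \<Rightarrow> real) \<Rightarrow> nat filter \<Rightarrow> (nat \<Rightarrow> real) \<Rightarrow> (nat \<Rightarrow> 'a) \<Rightarrow> (nat \<Rightarrow> 'a) set"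
where
  "ucone_class G N \<omega> d g = ucone_rel G N \<omega> d `` {g}"

definition ucone ::
  "('a, 'b) monoid_scheme \<Rightarrow> ('a \<Rightarrow> real) \<Rightarrow> nat filter \<Rightarrow> (nat \<Rightarrow> real) \<Rightarrow> (nat \<Rightarrow> 'a) set monoid"
where
  "ucone G N \<omega> d =
     \<lparr>carrier = carrier (ucone_seqs G N d) // ucone_rel G N \<omega> d,
      monoid.mult = set_mult (ucone_seqs G N d),
      one = ucone_class G N \<omega> d (\<lambda>k. \<one>\<^bsub>G\<^esub>)\<rparr>"

definition ucone_norm ::
  "('a, 'b) monoid_scheme \<Rightarrow> ('a \<Rightarrow> real) \<Rightarrow> nat filter \<Rightarrow> (nat \<Rightarrow> real) \<Rightarrow> (nat \<Rightarrow> 'a) set \<Rightarrow> real"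
where
  "ucone_norm G N \<omega> d X = the_elem ((\<lambda>g. Lim \<omega> (\<lambda>k. N (g k) / d k)) ` X)"

definition dir_cone_to_ucone ::
  "('a, 'b) monoid_scheme \<Rightarrow> ('a \<Rightarrow> real) \<Rightarrow> nat filter \<Rightarrow> (nat \<Rightarrow> real) \<Rightarrow> (real \<Rightarrow> 'a) set \<Rightarrow> (nat \<Rightarrow> 'a) set"
where
  "dir_cone_to_ucone G N \<omega> d X = the_elem ((\<lambda>g. ucone_class G N \<omega> d (\<lambda>k. g (d k))) ` X)"


section \<open>Integer and real vectors\<close>

definition real_group :: "real monoid" where
  "real_group = \<lparr>carrier = UNIV, monoid.mult = (+), one = 0\<rparr>"

definition int_vec_group :: "nat \<Rightarrow> (nat \<Rightarrow> int) monoid" where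
  "int_vec_group n = product_group {..<n} (\<lambda>_. integer_group)"

definition real_vec_group :: "nat \<Rightarrow> (nat \<Rightarrow> real) monoid" where
  "real_vec_group n = product_group {..<n} (\<lambda>_. real_group)"

definition int_L1_norm :: "nat \<Rightarrow> (nat \<Rightarrow> int) \<Rightarrow> real" where
  "int_L1_norm n v = (\<Sum>i<n. \<bar>real_of_int (v i)\<bar>)"

definition real_L1_norm :: "nat \<Rightarrow> (nat \<Rightarrow> real) \<Rightarrow> real" where
  "real_L1_norm n v = (\<Sum>i<n. \<bar>v i\<bar>)"


section \<open>Consistency of the definitions\<close>

lemma fr_words_Nil [simp]: "[] \<in> fr_words S"
  by (simp add: fr_words_def)

lemma fr_words_Cons:
  "(h, s) # w \<in> fr_words S \<longleftrightarrow>
     h \<in> S \<and> s \<noteq> 0 \<and> w \<in> fr_words S \<and> (w = [] \<or> fst (hd w) \<noteq> h)"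
  by (cases w) (auto simp: fr_words_def)

lemma fr_cons_closed: "w \<in> fr_words S \<Longrightarrow> g \<in> S \<Longrightarrow> fr_cons g r w \<in> fr_words S"
  by (cases w) (auto simp: fr_words_Cons)

lemma fr_cons_0: "w \<in> fr_words S \<Longrightarrow> fr_cons g 0 w = w"
  by (cases w) (auto simp: fr_words_Cons)

lemma fr_cons_add: "w \<in> fr_words S \<Longrightarrow> fr_cons g r (fr_cons g s w) = fr_cons g (r + s) w"
proof (cases w)
  case (Cons p v)
  assume "w \<in> fr_words S"
  then show ?thesis
    using Cons by (cases p; cases v) (auto simp: fr_words_Cons add.assoc)
qed auto

lemma fr_mult_cons:
  assumes "x \<in> fr_words S" "y \<in> fr_words S" "g \<in> S"
  shows "fr_cons g r x \<otimes>\<^bsub>FR S\<^esub> y = fr_cons g r (x \<otimes>\<^bsub>FR S\<^esub> y)"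
    and "x \<otimes>\<^bsub>FR S\<^esub> y \<in> fr_words S"
proof -
  have cl: "x \<otimes>\<^bsub>FR S\<^esub> y \<in> fr_words S" if "x \<in> fr_words S" for x
    using that by (induction x) (auto simp: FR_def assms fr_words_Cons fr_cons_closed)
  then show "x \<otimes>\<^bsub>FR S\<^esub> y \<in> fr_words S"
    using assms by blast
  show "fr_cons g r x \<otimes>\<^bsub>FR S\<^esub> y = fr_cons g r (x \<otimes>\<^bsub>FR S\<^esub> y)"
  proof (cases x)
    case Nil
    then show ?thesis using assms by (auto simp: FR_def fr_cons_0)
  next
    case (Cons p v)
    obtain h s where p: "p = (h, s)" by force
    have v: "v \<in> fr_words S" using assms Cons p by (auto simp: fr_words_Cons)
    have w: "foldr (\<lambda>(g, r). fr_cons g r) v y \<in> fr_words S"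
      using cl[OF v] by (simp add: FR_def)
    show ?thesis
      using Cons p fr_cons_add[OF w, of g r s] fr_cons_0[OF w, of g]
        fr_cons_0[OF fr_cons_closed[OF w, of h s], of g] assms
      by (auto simp: FR_def fr_words_Cons)
  qed
qed

lemma FR_assoc:
  assumes "x \<in> fr_words S" "y \<in> fr_words S" "z \<in> fr_words S"
  shows "x \<otimes>\<^bsub>FR S\<^esub> y \<otimes>\<^bsub>FR S\<^esub> z = x \<otimes>\<^bsub>FR S\<^esub> (y \<otimes>\<^bsub>FR S\<^esub> z)"
  using assms(1)
proof (induction x)
  case (Cons p v)
  obtain h s where p: "p = (h, s)" by force
  have v: "v \<in> fr_words S" "h \<in> S" using Cons.prems p by (auto simp: fr_words_Cons)
  have e: "(p # v) \<otimes>\<^bsub>FR S\<^esub> u = fr_cons h s (v \<otimes>\<^bsub>FR S\<^esub> u)" for u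
    by (simp add: FR_def p)
  show ?case
    using Cons.IH[OF v(1)] fr_mult_cons(1)[OF fr_mult_cons(2)[OF v(1) assms(2) v(2)] assms(3) v(2)]
    by (simp add: e)
qed (simp add: FR_def)

lemma fr_gen_closed: "g \<in> S \<Longrightarrow> fr_gen g r \<in> carrier (FR S)"
  unfolding fr_gen_def by (simp add: FR_def fr_cons_closed del: fr_cons.simps)

lemma fr_gen_mult:
  "g \<in> S \<Longrightarrow> w \<in> fr_words S \<Longrightarrow> fr_gen g r \<otimes>\<^bsub>FR S\<^esub> w = fr_cons g r w"
  using fr_mult_cons(1)[of "[]" S w g r] by (simp add: fr_gen_def FR_def)

lemma group_FR: "group (FR S)"
proof (rule groupI)
  fix x y z assume xyz: "x \<in> carrier (FR S)" "y \<in> carrier (FR S)" "z \<in> carrier (FR S)"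
  show "x \<otimes>\<^bsub>FR S\<^esub> y \<in> carrier (FR S)"
    using xyz fr_mult_cons(2)[of x S y] by (cases x) (auto simp: FR_def fr_words_Cons)
  show "x \<otimes>\<^bsub>FR S\<^esub> y \<otimes>\<^bsub>FR S\<^esub> z = x \<otimes>\<^bsub>FR S\<^esub> (y \<otimes>\<^bsub>FR S\<^esub> z)"
    using xyz by (intro FR_assoc) (auto simp: FR_def)
next
  fix x assume "x \<in> carrier (FR S)"
  then have "x \<in> fr_words S" by (auto simp: FR_def)
  then have "\<exists>y\<in>fr_words S. y \<otimes>\<^bsub>FR S\<^esub> x = []"
  proof (induction x)
    case (Cons p v)
    obtain h s where p: "p = (h, s)" by force
    have v: "v \<in> fr_words S" "h \<in> S" using Cons.prems p by (auto simp: fr_words_Cons)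
    obtain u where u: "u \<in> fr_words S" "u \<otimes>\<^bsub>FR S\<^esub> v = []"
      using Cons.IH v by blast
    have g: "fr_gen h (- s) \<in> fr_words S"
      using fr_gen_closed[OF v(2)] by (simp add: FR_def)
    have "u \<otimes>\<^bsub>FR S\<^esub> fr_gen h (- s) \<otimes>\<^bsub>FR S\<^esub> (p # v) = []"
      using FR_assoc[OF u(1) g Cons.prems] fr_gen_mult[OF v(2) Cons.prems, of "- s"] u
      by (simp add: p)
    then show ?case
      using fr_mult_cons(2)[OF u(1) g v(2)] by blast
  qed (auto simp: FR_def intro!: bexI[of _ "[]"])
  then show "\<exists>y\<in>carrier (FR S). y \<otimes>\<^bsub>FR S\<^esub> x = \<one>\<^bsub>FR S\<^esub>"
    by (simp add: FR_def)
qed (auto simp: FR_def)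

lemma fr_gen_add:
  "g \<in> S \<Longrightarrow> fr_gen g r \<otimes>\<^bsub>FR S\<^esub> fr_gen g s = fr_gen g (r + s)"
  using fr_gen_mult[of g S "fr_gen g s" r] fr_gen_closed[of g S s] fr_cons_add[of "[]" S g r s]
  by (simp add: fr_gen_def FR_def)

text \<open>
  The universal property of the free product, for the subgroup of words with all
  exponents in a subgroup \<open>A\<close> of the reals.
\<close>

lemma fr_fold_cons:
  assumes H: "group H" and cl: "\<And>g r. g \<in> S \<Longrightarrow> r \<in> A \<Longrightarrow> f g r \<in> carrier H"
    and add: "\<And>g r s. g \<in> S \<Longrightarrow> r \<in> A \<Longrightarrow> s \<in> A \<Longrightarrow> f g (r + s) = f g r \<otimes>\<^bsub>H\<^esub> f g s"
    and zero: "\<And>g. g \<in> S \<Longrightarrow> f g 0 = \<one>\<^bsub>H\<^esub>"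
    and w: "w \<in> fr_words S" "snd ` set w \<subseteq> A" and g: "g \<in> S" "r \<in> A"
  shows "fr_fold H f w \<in> carrier H"
    and "fr_fold H f (fr_cons g r w) = f g r \<otimes>\<^bsub>H\<^esub> fr_fold H f w"
proof -
  interpret H: group H by (rule H)
  have c: "fr_fold H f v \<in> carrier H" if "v \<in> fr_words S" "snd ` set v \<subseteq> A" for v
    using that by (induction v) (auto simp: fr_fold_def fr_words_Cons cl)
  then show "fr_fold H f w \<in> carrier H" using w by blast
  show "fr_fold H f (fr_cons g r w) = f g r \<otimes>\<^bsub>H\<^esub> fr_fold H f w"
  proof (cases w)
    case Nil
    then show ?thesis using cl g zero by (auto simp: fr_fold_def)
  next
    case (Cons p v)
    obtain h s where p: "p = (h, s)" by force
    have v: "v \<in> fr_words S" "snd ` set v \<subseteq> A" "h \<in> S" "s \<in> A"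
      using w Cons p by (auto simp: fr_words_Cons)
    have F: "fr_fold H f ((k, t) # u) = f k t \<otimes>\<^bsub>H\<^esub> fr_fold H f u" for k t u
      by (simp add: fr_fold_def)
    have a: "f g r \<otimes>\<^bsub>H\<^esub> (f g s \<otimes>\<^bsub>H\<^esub> fr_fold H f v) = f g (r + s) \<otimes>\<^bsub>H\<^esub> fr_fold H f v"
      using g v c[OF v(1,2)] by (simp add: add cl H.m_assoc)
    show ?thesis
      using Cons p a v g c[OF v(1,2)] zero cl by (auto simp: F)
  qed
qed

lemma fr_fold_mult:
  assumes H: "group H" and cl: "\<And>g r. g \<in> S \<Longrightarrow> r \<in> A \<Longrightarrow> f g r \<in> carrier H"
    and add: "\<And>g r s. g \<in> S \<Longrightarrow> r \<in> A \<Longrightarrow> s \<in> A \<Longrightarrow> f g (r + s) = f g r \<otimes>\<^bsub>H\<^esub> f g s"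
    and zero: "\<And>g. g \<in> S \<Longrightarrow> f g 0 = \<one>\<^bsub>H\<^esub>"
    and A: "\<And>r s. r \<in> A \<Longrightarrow> s \<in> A \<Longrightarrow> r + s \<in> A"
    and x: "x \<in> fr_words S" "snd ` set x \<subseteq> A" and y: "y \<in> fr_words S" "snd ` set y \<subseteq> A"
  shows "snd ` set (x \<otimes>\<^bsub>FR S\<^esub> y) \<subseteq> A"
    and "fr_fold H f (x \<otimes>\<^bsub>FR S\<^esub> y) = fr_fold H f x \<otimes>\<^bsub>H\<^esub> fr_fold H f y"
proof -
  interpret H: group H by (rule H)
  have consA: "snd ` set (fr_cons g r w) \<subseteq> A" if "snd ` set w \<subseteq> A" "r \<in> A" for g r w
    using that A by (cases w) (auto simp: image_subset_iff split: if_splits)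
  have "snd ` set (x \<otimes>\<^bsub>FR S\<^esub> y) \<subseteq> A \<and>
        fr_fold H f (x \<otimes>\<^bsub>FR S\<^esub> y) = fr_fold H f x \<otimes>\<^bsub>H\<^esub> fr_fold H f y"
    using x
  proof (induction x)
    case Nil
    have "fr_fold H f y \<in> carrier H"
      using y cl by (induction y) (auto simp: fr_fold_def fr_words_Cons)
    then show ?case using y by (simp add: FR_def fr_fold_def)
  next
    case (Cons p v)
    obtain h s where p: "p = (h, s)" by force
    have v: "v \<in> fr_words S" "snd ` set v \<subseteq> A" "h \<in> S" "s \<in> A"
      using Cons.prems p by (auto simp: fr_words_Cons)
    have e: "(p # v) \<otimes>\<^bsub>FR S\<^esub> y = fr_cons h s (v \<otimes>\<^bsub>FR S\<^esub> y)"
      by (simp add: FR_def p)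
    have vy: "v \<otimes>\<^bsub>FR S\<^esub> y \<in> fr_words S"
      using fr_mult_cons(2)[OF v(1) y(1) v(3)] .
    have IH: "snd ` set (v \<otimes>\<^bsub>FR S\<^esub> y) \<subseteq> A"
      "fr_fold H f (v \<otimes>\<^bsub>FR S\<^esub> y) = fr_fold H f v \<otimes>\<^bsub>H\<^esub> fr_fold H f y"
      using Cons.IH v by auto
    have "fr_fold H f v \<in> carrier H"
      by (rule fr_fold_cons(1)[OF H cl add zero v]; assumption)
    moreover have "fr_fold H f y \<in> carrier H"
      by (rule fr_fold_cons(1)[OF H cl add zero y v(3,4)]; assumption)
    moreover have "f h s \<in> carrier H"
      by (rule cl[OF v(3,4)])
    moreover have "fr_fold H f (p # v) = f h s \<otimes>\<^bsub>H\<^esub> fr_fold H f v"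
      by (simp add: fr_fold_def p)
    moreover have "fr_fold H f (fr_cons h s (v \<otimes>\<^bsub>FR S\<^esub> y)) = f h s \<otimes>\<^bsub>H\<^esub> fr_fold H f (v \<otimes>\<^bsub>FR S\<^esub> y)"
      by (rule fr_fold_cons(2)[OF H cl add zero vy IH(1) v(3,4)])
    ultimately show ?case
      using consA[OF IH(1) v(4)] IH(2) by (simp add: e H.m_assoc)
  qed
  then show "snd ` set (x \<otimes>\<^bsub>FR S\<^esub> y) \<subseteq> A"
    "fr_fold H f (x \<otimes>\<^bsub>FR S\<^esub> y) = fr_fold H f x \<otimes>\<^bsub>H\<^esub> fr_fold H f y"
    by auto
qed

lemma fr_gen_0: "fr_gen g 0 = \<one>\<^bsub>FR S\<^esub>"
  by (simp add: fr_gen_def FR_def)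

lemma fr_scale_hom: "fr_scale S t \<in> hom (FR S) (FR S)"
proof (rule homI)
  fix x y assume "x \<in> carrier (FR S)" "y \<in> carrier (FR S)"
  then have xy: "x \<in> fr_words S" "y \<in> fr_words S" by (auto simp: FR_def)
  interpret F: group "FR S" by (rule group_FR)
  show "fr_scale S t x \<in> carrier (FR S)"
    using xy(1) unfolding fr_scale_def fr_fold_def
  proof (induction x)
    case (Cons p v)
    then show ?case
      by (cases p) (auto simp: fr_words_Cons intro!: F.m_closed fr_gen_closed)
  qed auto
  show "fr_scale S t (x \<otimes>\<^bsub>FR S\<^esub> y) = fr_scale S t x \<otimes>\<^bsub>FR S\<^esub> fr_scale S t y"
    unfolding fr_scale_def
    by (rule fr_fold_mult(2)[where A = UNIV and S = S])
      (auto simp: group_FR fr_gen_closed fr_gen_add fr_gen_0[of _ S] distrib_left xy)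
qed

lemma fr_scale_gen: "g \<in> S \<Longrightarrow> fr_scale S t (fr_gen g r) = fr_gen g (t * r)"
  using group.is_monoid[OF group_FR[of S]] fr_gen_closed[of g S "t * r"]
  by (auto simp: fr_scale_def fr_fold_def fr_gen_def FR_def)

lemma inv_fr_gen: "g \<in> S \<Longrightarrow> inv\<^bsub>FR S\<^esub> fr_gen g r = fr_gen g (- r)"
  by (intro group.inv_equality[OF group_FR])
    (auto simp: fr_gen_closed fr_gen_add fr_gen_0[of _ S])

lemma FG_int_words:
  assumes "x \<in> carrier (FG S)"
  shows "x \<in> fr_words S" "snd ` set x \<subseteq> \<int>"
proof -
  have "x \<in> generate (FR S) (carrier (FR S) \<inter> (\<lambda>g. fr_gen g 1) ` S)"
    using assms by (simp add: FG_def carrier_subgroup_generated)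
  then have "x \<in> fr_words S \<and> snd ` set x \<subseteq> \<int>"
  proof induction
    case (incl h)
    then show ?case by (auto simp: FR_def fr_gen_def)
  next
    case (inv h)
    then obtain g where g: "g \<in> S" "h = fr_gen g 1" by auto
    then have "inv\<^bsub>FR S\<^esub> h = fr_gen g (- 1)" by (simp add: inv_fr_gen)
    then show ?case using fr_gen_closed[OF g(1), of "- 1"] by (auto simp: FR_def fr_gen_def)
  next
    case (eng h1 h2)
    have "h1 \<otimes>\<^bsub>FR S\<^esub> h2 \<in> fr_words S"
      using monoid.m_closed[OF group.is_monoid[OF group_FR[of S]], of h1 h2] eng.IH
      by (simp add: FR_def)
    moreover have "snd ` set (h1 \<otimes>\<^bsub>FR S\<^esub> h2) \<subseteq> \<int>"
      by (rule fr_fold_mult(1)[where H = "FR S" and f = fr_gen and S = S])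
        (use eng.IH in \<open>auto simp: group_FR fr_gen_closed fr_gen_add fr_gen_0[of _ S]\<close>)
    ultimately show ?case by blast
  qed (simp add: FR_def)
  then show "x \<in> fr_words S" "snd ` set x \<subseteq> \<int>" by auto
qed

lemma fg_eval_hom:
  assumes "group G"
  shows "fg_eval G \<in> hom (FG (carrier G)) G"
proof (rule homI)
  interpret G: group G by (rule assms)
  fix x y assume xy: "x \<in> carrier (FG (carrier G))" "y \<in> carrier (FG (carrier G))"
  have "fr_fold G (\<lambda>g r. g [^]\<^bsub>G\<^esub> \<lfloor>r\<rfloor>) x \<in> carrier G" if "x \<in> fr_words (carrier G)" for x
    using that by (induction x) (auto simp: fr_fold_def fr_words_Cons)
  then show "fg_eval G x \<in> carrier G"
    using FG_int_words(1)[OF xy(1)] by (simp add: fg_eval_def)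
  have "fr_fold G (\<lambda>g r. g [^]\<^bsub>G\<^esub> \<lfloor>r\<rfloor>) (x \<otimes>\<^bsub>FR (carrier G)\<^esub> y) =
        fr_fold G (\<lambda>g r. g [^]\<^bsub>G\<^esub> \<lfloor>r\<rfloor>) x \<otimes>\<^bsub>G\<^esub> fr_fold G (\<lambda>g r. g [^]\<^bsub>G\<^esub> \<lfloor>r\<rfloor>) y"
  proof (rule fr_fold_mult(2)[where A = \<int> and S = "carrier G"])
    fix g and r s :: real assume "g \<in> carrier G" "r \<in> \<int>" "s \<in> \<int>"
    moreover from \<open>r \<in> \<int>\<close> \<open>s \<in> \<int>\<close> have "\<lfloor>r + s\<rfloor> = \<lfloor>r\<rfloor> + \<lfloor>s\<rfloor>"
      by (metis Ints_cases floor_add_int floor_of_int)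
    ultimately show "g [^]\<^bsub>G\<^esub> \<lfloor>r + s\<rfloor> = g [^]\<^bsub>G\<^esub> \<lfloor>r\<rfloor> \<otimes>\<^bsub>G\<^esub> g [^]\<^bsub>G\<^esub> \<lfloor>s\<rfloor>"
      by (simp add: G.int_pow_mult)
  qed (use FG_int_words[OF xy(1)] FG_int_words[OF xy(2)] assms in simp_all)
  then show "fg_eval G (x \<otimes>\<^bsub>FG (carrier G)\<^esub> y) = fg_eval G x \<otimes>\<^bsub>G\<^esub> fg_eval G y"
    by (simp add: fg_eval_def FG_def subgroup_generated_def)
qed

lemma fg_eval_gen: "group G \<Longrightarrow> g \<in> carrier G \<Longrightarrow> fg_eval G (fr_gen g 1) = g"
  by (simp add: fg_eval_def fr_fold_def fr_gen_def group.int_pow_1 group.is_monoid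
      monoid.r_one)

lemma conj_inv_normed_int_vec_group:
  "conj_inv_normed_group (int_vec_group n) (int_L1_norm n)"
proof -
  interpret G: group "int_vec_group n" by (simp add: int_vec_group_def)
  have inv: "inv\<^bsub>int_vec_group n\<^esub> x = (\<lambda>i\<in>{..<n}. - x i)" if "x \<in> carrier (int_vec_group n)" for x
    using that by (intro G.inv_equality) (auto simp: int_vec_group_def fun_eq_iff)
  show ?thesis
  proof
    fix x y assume x: "x \<in> carrier (int_vec_group n)" and y: "y \<in> carrier (int_vec_group n)"
    show "0 \<le> int_L1_norm n x" by (simp add: int_L1_norm_def sum_nonneg)
    show "int_L1_norm n x = 0 \<longleftrightarrow> x = \<one>\<^bsub>int_vec_group n\<^esub>"
      using x by (auto simp: int_L1_norm_def sum_nonneg_eq_0_iff int_vec_group_def fun_eq_iff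
          PiE_def extensional_def)
    show "int_L1_norm n (inv\<^bsub>int_vec_group n\<^esub> x) = int_L1_norm n x"
      using x by (simp add: inv int_L1_norm_def)
    show "int_L1_norm n (x \<otimes>\<^bsub>int_vec_group n\<^esub> y) \<le> int_L1_norm n x + int_L1_norm n y"
      by (simp add: int_L1_norm_def int_vec_group_def flip: sum.distrib) (intro sum_mono, auto)
    show "int_L1_norm n (y \<otimes>\<^bsub>int_vec_group n\<^esub> x \<otimes>\<^bsub>int_vec_group n\<^esub> inv\<^bsub>int_vec_group n\<^esub> y) = int_L1_norm n x"
      using y by (simp add: inv) (simp add: int_L1_norm_def int_vec_group_def)
  qed
qed

end

theory Submission
  imports Defs
begin

text \<open>
  A family \<open>g\<close> of integer vectors indexed by a scaling set \<open>T\<close> represents an element of the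
  directional cone exactly when \<open>g t / t\<close> converges in \<open>\<real>\<^sup>n\<close>, and its pseudonorm is then the
  \<open>L\<^sup>1\<close>-norm of the limit, the direction of the family.

  The reason is that the homomorphism \<open>real_eval\<close> from the free product to \<open>\<real>\<^sup>n\<close>, which
  multiplies the vector of each syllable by its exponent and adds up, is 1-Lipschitz
  (\<open>real_eval_le_norm\<close>) and has a norm-preserving section \<open>axis_word\<close>, the product of one
  syllable for each coordinate axis. Applied to a rescaled lift \<open>w t\<close> of \<open>g t\<close>, the map
  \<open>real_eval\<close> yields \<open>g t / t\<close>; so a Cauchy lift forces convergence, and the limit is no longer
  than the lift (\<open>DG_direction\<close>). Conversely, if \<open>g t / t\<close> tends to \<open>v\<close>, lifting the integer
  part of \<open>t v\<close> along the axes and correcting by one letter gives a lift whose rescalings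
  converge to \<open>axis_word n v\<close>, an element of the same norm as \<open>v\<close> (\<open>DG_lift\<close>).

  Sequences of linear growth have a direction along an ultrafilter, by compactness, and two
  of them are asymptotic exactly when the directions agree. Thus every cone in question is a
  group of families modulo those of direction \<open>0\<close>, normed by the length of the direction, and
  every integer-part family \<open>t \<mapsto> \<lfloor>t v\<rfloor>\<close> realises its \<open>v\<close>. All cones are therefore copies of
  \<open>\<real>\<^sup>n\<close> (\<open>isometric_quotient\<close>). Restriction to a smaller scaling set and evaluation along a
  scaling sequence preserve directions, so they induce the identity of \<open>\<real>\<^sup>n\<close>
  (\<open>isometric_iso_quotients\<close>).
\<close>

section \<open>Quotients by the elements of norm zero\<close>

text \<open>
  A pseudonorm \<open>Q\<close> on \<open>A\<close> that is pulled back from a norm along a surjection \<open>L\<close>. Only the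
  values of \<open>Q\<close> on the carrier are constrained, since the cone norms are arbitrary elsewhere.
\<close>

locale norm_presentation = group_hom A H L + conj_inv_normed_group H M
  for A (structure) and H (structure) and L and M +
  fixes Q :: "'a \<Rightarrow> real"
  assumes onto: "L ` carrier A = carrier H"
    and Q_eq: "x \<in> carrier A \<Longrightarrow> Q x = M (L x)"
begin

definition null :: "'a set" where
  "null = {x \<in> carrier A. Q x = 0}"

lemma null_eq_kernel: "null = kernel A H L"
  by (auto simp: null_def kernel_def Q_eq norm_eq_0_iff)

lemma null_normal: "null \<lhd> A"
  by (simp add: null_eq_kernel normal_kernel)

lemma group_quotient: "group (A Mod null)"
  by (simp add: normal.factorgroup_is_group null_normal)

lemma coset_memD:
  assumes "x \<in> null #>\<^bsub>A\<^esub> a" "a \<in> carrier A"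
  shows "x \<in> carrier A" "L x = L a"
  using assms by (auto simp: null_eq_kernel kernel_def r_coset_def)

lemma coset_eq_iff:
  assumes "a \<in> carrier A" "b \<in> carrier A"
  shows "null #>\<^bsub>A\<^esub> a = null #>\<^bsub>A\<^esub> b \<longleftrightarrow> L a = L b"
proof
  assume "null #>\<^bsub>A\<^esub> a = null #>\<^bsub>A\<^esub> b"
  then have "a \<in> null #>\<^bsub>A\<^esub> b"
    using G.rcos_self[OF assms(1) normal_imp_subgroup[OF null_normal]] by simp
  then show "L a = L b"
    using coset_memD assms by blast
next
  assume "L a = L b"
  then show "null #>\<^bsub>A\<^esub> a = null #>\<^bsub>A\<^esub> b"
    unfolding null_eq_kernel using FactGroup_subset assms by (metis subset_antisym)
qed

lemma coset_eq_fibre: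
  assumes "a \<in> carrier A"
  shows "null #>\<^bsub>A\<^esub> a = {x \<in> carrier A. L x = L a}"
proof
  show "null #>\<^bsub>A\<^esub> a \<subseteq> {x \<in> carrier A. L x = L a}"
    using coset_memD[OF _ assms] by blast
  show "{x \<in> carrier A. L x = L a} \<subseteq> null #>\<^bsub>A\<^esub> a"
    using coset_eq_iff[OF _ assms] G.rcos_self[OF _ normal_imp_subgroup[OF null_normal]] by blast
qed

text \<open>
  A function on \<open>A\<close> that depends only on \<open>L\<close> is constant on cosets, so \<^const>\<open>the_elem\<close> of its
  image recovers its value at any representative.
\<close>

lemma the_elem_coset:
  assumes "a \<in> carrier A" and "\<And>x. x \<in> carrier A \<Longrightarrow> L x = L a \<Longrightarrow> f x = f a"
  shows "the_elem (f ` (null #>\<^bsub>A\<^esub> a)) = f a"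
proof -
  have "a \<in> null #>\<^bsub>A\<^esub> a"
    using G.rcos_self[OF assms(1) normal_imp_subgroup[OF null_normal]] by simp
  then have "f ` (null #>\<^bsub>A\<^esub> a) = {f a}"
    using coset_memD[OF _ assms(1)] assms(2) by blast
  then show ?thesis by simp
qed

lemma the_elem_norm_coset:
  "a \<in> carrier A \<Longrightarrow> the_elem (Q ` (null #>\<^bsub>A\<^esub> a)) = M (L a)"
  using the_elem_coset[of a Q] by (simp add: Q_eq)

lemma carrier_quotient: "carrier (A Mod null) = (\<lambda>a. null #>\<^bsub>A\<^esub> a) ` carrier A"
  by (simp add: carrier_FactGroup)

end

lemma isometric_isoI:
  assumes "group A" "group B" "\<phi> \<in> iso A B"
    and norm: "\<And>x. x \<in> carrier A \<Longrightarrow> N' (\<phi> x) = N x"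
  shows "isometric_iso A N B N' \<phi>"
proof -
  interpret \<phi>: group_hom A B \<phi>
    using assms by (simp add: group_hom_def group_hom_axioms_def iso_imp_homomorphism)
  have "group_dist B N' (\<phi> x) (\<phi> y) = group_dist A N x y"
    if "x \<in> carrier A" "y \<in> carrier A" for x y
    using that norm[of "inv\<^bsub>A\<^esub> x \<otimes>\<^bsub>A\<^esub> y"] by (simp add: group_dist_def)
  then show ?thesis
    using assms by (simp add: isometric_iso_def)
qed

lemma isometric_iso_cong:
  assumes "group A" "isometric_iso A N B N' \<phi>" and eq: "\<And>x. x \<in> carrier A \<Longrightarrow> \<phi> x = \<psi> x"
  shows "isometric_iso A N B N' \<psi>"
proof -
  have "\<psi> \<in> iso A B"
    using assms group.iso_eq[OF \<open>group A\<close>, of \<phi> B \<psi>] by (simp add: isometric_iso_def)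
  then show ?thesis using assms by (simp add: isometric_iso_def)
qed

text \<open>
  The first isomorphism theorem, with norms: killing the elements of norm zero is the same
  as dividing by the kernel of \<open>L\<close>, because \<open>M\<close> is a genuine norm.
\<close>

theorem (in norm_presentation) isometric_quotient:
  "isometric_iso (A Mod null) (\<lambda>X. the_elem (Q ` X)) H M (\<lambda>X. the_elem (L ` X))"
proof (rule isometric_isoI)
  show "(\<lambda>X. the_elem (L ` X)) \<in> iso (A Mod null) H"
    unfolding null_eq_kernel by (rule FactGroup_iso_set[OF onto])
  show "M (the_elem (L ` X)) = the_elem (Q ` X)" if "X \<in> carrier (A Mod null)" for X
    using that by (auto simp: carrier_quotient the_elem_coset the_elem_norm_coset)
qed (auto simp: group_quotient)

text \<open>
  Two quotients presented over the same \<open>H\<close> are both copies of \<open>H\<close>, and a map of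
  representatives that respects the two projections to \<open>H\<close> induces the resulting identification.
  Compatibility also makes the induced map multiplicative, because the classes are
  determined by their projections.
\<close>

theorem isometric_iso_quotients:
  assumes A: "norm_presentation A H L M Q" and B: "norm_presentation B H L' M Q'"
    and r: "\<And>a. a \<in> carrier A \<Longrightarrow> r a \<in> carrier B" "\<And>a. a \<in> carrier A \<Longrightarrow> L' (r a) = L a"
  defines "K \<equiv> norm_presentation.null A Q" and "K' \<equiv> norm_presentation.null B Q'"
  shows "isometric_iso (A Mod K) (\<lambda>X. the_elem (Q ` X)) (B Mod K') (\<lambda>X. the_elem (Q' ` X))
           (\<lambda>X. the_elem ((\<lambda>a. K' #>\<^bsub>B\<^esub> r a) ` X))"
    (is "isometric_iso _ _ _ _ ?\<phi>")
proof -
  interpret A: norm_presentation A H L M Q by (rule A)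
  interpret B: norm_presentation B H L' M Q' by (rule B)
  interpret nA: normal K A unfolding K_def by (rule A.null_normal)
  interpret nB: normal K' B unfolding K'_def by (rule B.null_normal)
  note carrier_A = A.carrier_quotient[folded K_def] and carrier_B = B.carrier_quotient[folded K'_def]
  note coset_A = A.coset_eq_iff[folded K_def] and coset_B = B.coset_eq_iff[folded K'_def]
  have \<phi>: "?\<phi> (K #>\<^bsub>A\<^esub> a) = K' #>\<^bsub>B\<^esub> r a" if "a \<in> carrier A" for a
    using that r by (intro A.the_elem_coset[folded K_def]) (auto simp: coset_B)
  have "?\<phi> \<in> hom (A Mod K) (B Mod K')"
  proof (rule homI)
    fix X Y assume "X \<in> carrier (A Mod K)" "Y \<in> carrier (A Mod K)"
    then obtain a b where ab: "a \<in> carrier A" "b \<in> carrier A" "X = K #>\<^bsub>A\<^esub> a" "Y = K #>\<^bsub>A\<^esub> b"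
      by (auto simp: carrier_A)
    then show "?\<phi> X \<in> carrier (B Mod K')"
      using r \<phi>[OF ab(1)] by (auto simp: carrier_B)
    have "K' #>\<^bsub>B\<^esub> r (a \<otimes>\<^bsub>A\<^esub> b) = K' #>\<^bsub>B\<^esub> (r a \<otimes>\<^bsub>B\<^esub> r b)"
      using ab r by (simp add: coset_B)
    then show "?\<phi> (X \<otimes>\<^bsub>A Mod K\<^esub> Y) = ?\<phi> X \<otimes>\<^bsub>B Mod K'\<^esub> ?\<phi> Y"
      using ab r by (simp add: nA.rcos_sum nB.rcos_sum \<phi>)
  qed
  moreover have "inj_on ?\<phi> (carrier (A Mod K))"
  proof (rule inj_onI)
    fix X Y assume "X \<in> carrier (A Mod K)" "Y \<in> carrier (A Mod K)" and eq: "?\<phi> X = ?\<phi> Y"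
    then obtain a b where ab: "a \<in> carrier A" "b \<in> carrier A" "X = K #>\<^bsub>A\<^esub> a" "Y = K #>\<^bsub>A\<^esub> b"
      by (auto simp: carrier_A)
    then have "L a = L b"
      using eq r \<phi>[OF ab(1)] \<phi>[OF ab(2)] by (simp add: coset_B)
    then show "X = Y"
      using ab by (simp add: coset_A)
  qed
  moreover have "carrier (B Mod K') \<subseteq> ?\<phi> ` carrier (A Mod K)"
  proof
    fix Y assume "Y \<in> carrier (B Mod K')"
    then obtain b where b: "b \<in> carrier B" "Y = K' #>\<^bsub>B\<^esub> b"
      by (auto simp: carrier_B)
    obtain a where a: "a \<in> carrier A" "L a = L' b"
      using A.onto B.hom_closed[OF b(1)] by (metis imageE)
    then have "?\<phi> (K #>\<^bsub>A\<^esub> a) = Y"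
      using b r by (simp add: \<phi> coset_B)
    then show "Y \<in> ?\<phi> ` carrier (A Mod K)"
      using a by (force simp: carrier_A)
  qed
  ultimately have "?\<phi> \<in> iso (A Mod K) (B Mod K')"
    by (auto simp: iso_def bij_betw_def hom_def)
  then show ?thesis
  proof (rule isometric_isoI[rotated 2])
    fix X assume "X \<in> carrier (A Mod K)"
    then obtain a where a: "a \<in> carrier A" "X = K #>\<^bsub>A\<^esub> a"
      by (auto simp: carrier_A)
    then show "the_elem (Q' ` ?\<phi> X) = the_elem (Q ` X)"
      using r by (simp add: \<phi> A.the_elem_norm_coset[folded K_def] B.the_elem_norm_coset[folded K'_def])
  qed (auto simp: K_def K'_def A.group_quotient B.group_quotient)
qed

section \<open>Conjugation-invariant pseudonorms\<close>

locale conj_inv_pseudonormed_group = group G for G (structure) +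
  fixes N :: "'a \<Rightarrow> real"
  assumes pnorm_nonneg: "x \<in> carrier G \<Longrightarrow> 0 \<le> N x"
    and pnorm_one: "N \<one> = 0"
    and pnorm_inv: "x \<in> carrier G \<Longrightarrow> N (inv x) = N x"
    and pnorm_mult: "x \<in> carrier G \<Longrightarrow> y \<in> carrier G \<Longrightarrow> N (x \<otimes> y) \<le> N x + N y"
    and pnorm_conj: "x \<in> carrier G \<Longrightarrow> h \<in> carrier G \<Longrightarrow> N (h \<otimes> x \<otimes> inv h) \<le> N x"
begin

abbreviation dst :: "'a \<Rightarrow> 'a \<Rightarrow> real" where
  "dst \<equiv> group_dist G N"

lemma dst_commute: "x \<in> carrier G \<Longrightarrow> y \<in> carrier G \<Longrightarrow> dst x y = dst y x"
  using pnorm_inv[of "inv x \<otimes> y"] by (simp add: group_dist_def inv_mult_group)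

lemma dst_triangle:
  assumes "x \<in> carrier G" "y \<in> carrier G" "z \<in> carrier G"
  shows "dst x z \<le> dst x y + dst y z"
proof -
  have "inv x \<otimes> z = (inv x \<otimes> y) \<otimes> (inv y \<otimes> z)"
    using assms by (metis inv_closed inv_solve_left m_assoc m_closed)
  then show ?thesis
    using pnorm_mult[of "inv x \<otimes> y" "inv y \<otimes> z"] assms by (simp add: group_dist_def)
qed

lemma norm_le_add_dst:
  assumes "x \<in> carrier G" "y \<in> carrier G"
  shows "N y \<le> N x + dst x y"
  using dst_triangle[of \<one> x y] assms by (simp add: group_dist_def)

lemma abs_norm_diff_le: "x \<in> carrier G \<Longrightarrow> y \<in> carrier G \<Longrightarrow> \<bar>N x - N y\<bar> \<le> dst x y"
  using norm_le_add_dst[of x y] norm_le_add_dst[of y x] dst_commute[of x y] by simp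

text \<open>Moving \<open>y\<close> across the difference of \<open>x\<close> and \<open>x'\<close> costs nothing, by conjugation invariance.\<close>

lemma dst_mult_le:
  assumes "x \<in> carrier G" "x' \<in> carrier G" "y \<in> carrier G" "y' \<in> carrier G"
  shows "dst (x \<otimes> y) (x' \<otimes> y') \<le> dst x x' + dst y y'"
proof -
  have "inv (x \<otimes> y) \<otimes> (x' \<otimes> y') = (inv y \<otimes> (inv x \<otimes> x') \<otimes> inv (inv y)) \<otimes> (inv y \<otimes> y')"
    using assms by (simp add: m_assoc inv_mult_group) (simp flip: m_assoc)
  then have "dst (x \<otimes> y) (x' \<otimes> y') \<le> N (inv y \<otimes> (inv x \<otimes> x') \<otimes> inv (inv y)) + dst y y'"
    using assms pnorm_mult unfolding group_dist_def by simp
  also have "N (inv y \<otimes> (inv x \<otimes> x') \<otimes> inv (inv y)) \<le> dst x x'"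
    using assms pnorm_conj[of "inv x \<otimes> x'" "inv y"] unfolding group_dist_def by simp
  finally show ?thesis by simp
qed

end

section \<open>The pseudonorm of the free product of copies of the reals\<close>

text \<open>A normal form is the product of its syllables.\<close>

lemma FR_induct [consumes 1, case_names one mult]:
  assumes "x \<in> carrier (FR S)" and "P \<one>\<^bsub>FR S\<^esub>"
    and "\<And>g r w. g \<in> S \<Longrightarrow> w \<in> carrier (FR S) \<Longrightarrow> P w \<Longrightarrow> P (fr_gen g r \<otimes>\<^bsub>FR S\<^esub> w)"
  shows "P x"
  using assms(1)
proof (induction x)
  case Nil
  show ?case using assms(2) by (simp add: FR_def)
next
  case (Cons p w)
  obtain g r where p: "p = (g, r)" by (cases p)
  have g: "g \<in> S" and w: "w \<in> carrier (FR S)" and pw: "p # w \<in> fr_words S"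
    using Cons.prems p by (auto simp: FR_def fr_words_Cons)
  have "fr_gen g r \<otimes>\<^bsub>FR S\<^esub> w = p # w"
    using pw fr_gen_mult[OF g, of w r] p by (cases w) (auto simp: fr_words_Cons)
  then show ?case
    using assms(3)[OF g w Cons.IH[OF w], of r] by simp
qed

context conj_inv_normed_group
begin

abbreviation F :: "('a \<times> real) list monoid" where
  "F \<equiv> FR (carrier G)"

text \<open>
  The pairs of an element and the cost of one of its expressions as a product of conjugates.
  Signs are absorbed by the real exponents, since the inverse of the element \<open>r\<close> of a copy of
  the reals is the element \<open>- r\<close> at the same cost; this leaves a plain induction principle.
\<close>

inductive expr_cost :: "('a \<times> real) list \<Rightarrow> real \<Rightarrow> bool" where
  one: "expr_cost \<one>\<^bsub>F\<^esub> 0"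
| step: "h \<in> carrier F \<Longrightarrow> g \<in> carrier G \<Longrightarrow> expr_cost x c \<Longrightarrow>
    expr_cost ((h \<otimes>\<^bsub>F\<^esub> fr_gen g r \<otimes>\<^bsub>F\<^esub> inv\<^bsub>F\<^esub> h) \<otimes>\<^bsub>F\<^esub> x) (\<bar>r\<bar> * N g + c)"

lemma fr_norm_eq_Inf_cost: "fr_norm G N x = Inf {c. expr_cost x c}"
proof -
  interpret F: group F by (rule group_FR)
  let ?term = "\<lambda>(h, g, r, e) y. (h \<otimes>\<^bsub>F\<^esub> fr_gen g r [^]\<^bsub>F\<^esub> e \<otimes>\<^bsub>F\<^esub> inv\<^bsub>F\<^esub> h) \<otimes>\<^bsub>F\<^esub> y"
  let ?ok = "\<lambda>ps. set ps \<subseteq> carrier F \<times> carrier G \<times> (UNIV :: real set) \<times> {1, - 1 :: int}"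
  let ?cost = "\<lambda>ps. \<Sum>(h, g, r, e :: int)\<leftarrow>ps. \<bar>r\<bar> * N g"
  have sign: "fr_gen g r [^]\<^bsub>F\<^esub> e = fr_gen g (e * r)" if "g \<in> carrier G" "e \<in> {1, - 1}" for g and r :: real and e :: int
    using that by (auto simp: fr_gen_closed F.int_pow_neg inv_fr_gen)
  have "expr_cost (foldr ?term ps \<one>\<^bsub>F\<^esub>) (?cost ps)" if "?ok ps" for ps
    using that
  proof (induction ps)
    case (Cons p ps)
    obtain h g r e where p: "p = (h, g, r, e)" by (cases p)
    have hg: "h \<in> carrier F" "g \<in> carrier G" and e: "e \<in> {1, - 1}" and ps: "?ok ps"
      using Cons.prems p by auto
    then have "\<bar>real_of_int e * r\<bar> = \<bar>r\<bar>" by auto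
    then show ?case
      using step[OF hg Cons.IH[OF ps], of "real_of_int e * r"] by (simp add: p sign[OF hg(2) e])
  qed (simp add: one)
  moreover have "\<exists>ps. ?ok ps \<and> x = foldr ?term ps \<one>\<^bsub>F\<^esub> \<and> c = ?cost ps" if "expr_cost x c" for x c
    using that
  proof induction
    case one
    show ?case by (intro exI[of _ "[]"]) simp
  next
    case (step h g x c r)
    then obtain ps where "?ok ps" "x = foldr ?term ps \<one>\<^bsub>F\<^esub>" "c = ?cost ps" by blast
    then show ?case
      using step.hyps by (intro exI[of _ "(h, g, r, 1) # ps"]) (simp add: fr_gen_closed)
  qed
  ultimately have "{?cost ps | ps. ?ok ps \<and> x = foldr ?term ps \<one>\<^bsub>F\<^esub>} = {c. expr_cost x c}"
    by blast
  then show ?thesis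
    by (simp add: fr_norm_def Let_def)
qed

lemma expr_cost_closed: "expr_cost x c \<Longrightarrow> x \<in> carrier F"
proof (induction rule: expr_cost.induct)
  case one
  show ?case by (simp add: group.is_monoid group_FR)
next
  case (step h g x c r)
  interpret F: group F by (rule group_FR)
  show ?case using step by (simp add: fr_gen_closed)
qed

lemma expr_cost_nonneg: "expr_cost x c \<Longrightarrow> 0 \<le> c"
  by (induction rule: expr_cost.induct) (auto simp: norm_nonneg)

lemma expr_cost_mult: "expr_cost x c \<Longrightarrow> expr_cost y d \<Longrightarrow> expr_cost (x \<otimes>\<^bsub>F\<^esub> y) (c + d)"
proof (induction rule: expr_cost.induct)
  case one
  interpret F: group F by (rule group_FR)
  show ?case using one by (simp add: expr_cost_closed)
next
  case (step h g x c r)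
  interpret F: group F by (rule group_FR)
  show ?case
    using step expr_cost.step[of h g "x \<otimes>\<^bsub>F\<^esub> y" "c + d" r]
    by (simp add: F.m_assoc fr_gen_closed expr_cost_closed add.assoc)
qed

lemma expr_cost_gen_conj:
  assumes "h \<in> carrier F" "g \<in> carrier G"
  shows "expr_cost (h \<otimes>\<^bsub>F\<^esub> fr_gen g r \<otimes>\<^bsub>F\<^esub> inv\<^bsub>F\<^esub> h) (\<bar>r\<bar> * N g)"
proof -
  interpret F: group F by (rule group_FR)
  show ?thesis using step[OF assms one, of r] assms by (simp add: fr_gen_closed)
qed

lemma expr_cost_conj:
  "expr_cost x c \<Longrightarrow> k \<in> carrier F \<Longrightarrow> expr_cost (k \<otimes>\<^bsub>F\<^esub> x \<otimes>\<^bsub>F\<^esub> inv\<^bsub>F\<^esub> k) c"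
proof (induction rule: expr_cost.induct)
  case one
  interpret F: group F by (rule group_FR)
  show ?case using one expr_cost.one by simp
next
  case (step h g x c r)
  interpret F: group F by (rule group_FR)
  have x: "x \<in> carrier F" using step by (simp add: expr_cost_closed)
  have "k \<otimes>\<^bsub>F\<^esub> ((h \<otimes>\<^bsub>F\<^esub> fr_gen g r \<otimes>\<^bsub>F\<^esub> inv\<^bsub>F\<^esub> h) \<otimes>\<^bsub>F\<^esub> x) \<otimes>\<^bsub>F\<^esub> inv\<^bsub>F\<^esub> k =
    ((k \<otimes>\<^bsub>F\<^esub> h) \<otimes>\<^bsub>F\<^esub> fr_gen g r \<otimes>\<^bsub>F\<^esub> inv\<^bsub>F\<^esub> (k \<otimes>\<^bsub>F\<^esub> h)) \<otimes>\<^bsub>F\<^esub> (k \<otimes>\<^bsub>F\<^esub> x \<otimes>\<^bsub>F\<^esub> inv\<^bsub>F\<^esub> k)"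
    using step x F.inv_solve_left[of k x "k \<otimes>\<^bsub>F\<^esub> x"]
    by (simp add: F.m_assoc F.inv_mult_group fr_gen_closed) (simp flip: F.m_assoc)
  then show ?case
    using expr_cost.step[of "k \<otimes>\<^bsub>F\<^esub> h" g _ c r] step by simp
qed

lemma expr_cost_inv: "expr_cost x c \<Longrightarrow> expr_cost (inv\<^bsub>F\<^esub> x) c"
proof (induction rule: expr_cost.induct)
  case one
  interpret F: group F by (rule group_FR)
  show ?case using expr_cost.one by simp
next
  case (step h g x c r)
  interpret F: group F by (rule group_FR)
  have "inv\<^bsub>F\<^esub> ((h \<otimes>\<^bsub>F\<^esub> fr_gen g r \<otimes>\<^bsub>F\<^esub> inv\<^bsub>F\<^esub> h) \<otimes>\<^bsub>F\<^esub> x) =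
    inv\<^bsub>F\<^esub> x \<otimes>\<^bsub>F\<^esub> (h \<otimes>\<^bsub>F\<^esub> fr_gen g (- r) \<otimes>\<^bsub>F\<^esub> inv\<^bsub>F\<^esub> h)"
    using step by (simp add: F.m_assoc F.inv_mult_group fr_gen_closed expr_cost_closed inv_fr_gen)
  then show ?case
    using expr_cost_mult[OF step.IH expr_cost_gen_conj[of h g "- r"]] step.hyps
    by (simp add: add.commute)
qed

lemma expr_cost_gen: "g \<in> carrier G \<Longrightarrow> expr_cost (fr_gen g r) (\<bar>r\<bar> * N g)"
proof -
  interpret F: group F by (rule group_FR)
  show "g \<in> carrier G \<Longrightarrow> ?thesis"
    using expr_cost_gen_conj[of "\<one>\<^bsub>F\<^esub>" g r] by (simp add: fr_gen_closed)
qed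

lemma expr_cost_exists: "x \<in> carrier F \<Longrightarrow> \<exists>c. expr_cost x c"
  by (induction rule: FR_induct) (blast intro: expr_cost.one expr_cost_mult expr_cost_gen)+

lemma fr_norm_le_cost: "expr_cost x c \<Longrightarrow> fr_norm G N x \<le> c"
  unfolding fr_norm_eq_Inf_cost by (intro cInf_lower bdd_belowI[of _ 0]) (auto intro: expr_cost_nonneg)

lemma fr_norm_greatest:
  "x \<in> carrier F \<Longrightarrow> (\<And>c. expr_cost x c \<Longrightarrow> b \<le> c) \<Longrightarrow> b \<le> fr_norm G N x"
  unfolding fr_norm_eq_Inf_cost using expr_cost_exists[of x] by (intro cInf_greatest) auto

lemma fr_norm_gen_le: "g \<in> carrier G \<Longrightarrow> fr_norm G N (fr_gen g r) \<le> \<bar>r\<bar> * N g"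
  by (intro fr_norm_le_cost expr_cost_gen)

lemma conj_inv_pseudonormed_FR: "conj_inv_pseudonormed_group F (fr_norm G N)"
proof -
  interpret F: group F by (rule group_FR)
  have inv_le: "fr_norm G N (inv\<^bsub>F\<^esub> x) \<le> fr_norm G N x" if "x \<in> carrier F" for x
    using that by (intro fr_norm_greatest fr_norm_le_cost expr_cost_inv)
  show ?thesis
  proof
    fix x y assume x: "x \<in> carrier F" and y: "y \<in> carrier F"
    show "0 \<le> fr_norm G N x"
      using x by (intro fr_norm_greatest expr_cost_nonneg)
    show "fr_norm G N (inv\<^bsub>F\<^esub> x) = fr_norm G N x"
      using x inv_le[of x] inv_le[of "inv\<^bsub>F\<^esub> x"] by simp
    have "fr_norm G N (x \<otimes>\<^bsub>F\<^esub> y) - fr_norm G N y \<le> c" if "expr_cost x c" for c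
    proof -
      have "fr_norm G N (x \<otimes>\<^bsub>F\<^esub> y) - c \<le> fr_norm G N y"
      proof (rule fr_norm_greatest[OF y])
        fix d assume "expr_cost y d"
        then show "fr_norm G N (x \<otimes>\<^bsub>F\<^esub> y) - c \<le> d"
          using fr_norm_le_cost[OF expr_cost_mult[OF that]] by fastforce
      qed
      then show ?thesis by simp
    qed
    then show "fr_norm G N (x \<otimes>\<^bsub>F\<^esub> y) \<le> fr_norm G N x + fr_norm G N y"
      using fr_norm_greatest[OF x, of "fr_norm G N (x \<otimes>\<^bsub>F\<^esub> y) - fr_norm G N y"] by simp
    show "fr_norm G N (y \<otimes>\<^bsub>F\<^esub> x \<otimes>\<^bsub>F\<^esub> inv\<^bsub>F\<^esub> y) \<le> fr_norm G N x"
      using x y by (intro fr_norm_greatest fr_norm_le_cost expr_cost_conj)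
  next
    show "fr_norm G N \<one>\<^bsub>F\<^esub> = 0"
      by (intro antisym fr_norm_greatest fr_norm_le_cost expr_cost.one) (auto intro: expr_cost_nonneg)
  qed
qed

text \<open>
  The pseudonorm is the largest one with the prescribed bounds on the generators: any
  homomorphism to a group with conjugation-invariant norm respecting these bounds takes an
  expression of \<open>x\<close> to an expression of its image at no greater cost.
\<close>

lemma hom_norm_le_fr_norm:
  assumes H: "conj_inv_normed_group H M" and \<Phi>: "\<Phi> \<in> hom F H"
    and gen: "\<And>g r. g \<in> carrier G \<Longrightarrow> M (\<Phi> (fr_gen g r)) \<le> \<bar>r\<bar> * N g"
    and x: "x \<in> carrier F"
  shows "M (\<Phi> x) \<le> fr_norm G N x"
proof (rule fr_norm_greatest[OF x])
  interpret F: group F by (rule group_FR)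
  interpret H: conj_inv_normed_group H M by (rule H)
  interpret \<Phi>: group_hom F H \<Phi>
    using \<Phi> by unfold_locales
  fix c assume "expr_cost x c"
  then show "M (\<Phi> x) \<le> c"
  proof induction
    case one
    show ?case using H.norm_eq_0_iff[of "\<one>\<^bsub>H\<^esub>"] by simp
  next
    case (step h g x c r)
    let ?k = "h \<otimes>\<^bsub>F\<^esub> fr_gen g r \<otimes>\<^bsub>F\<^esub> inv\<^bsub>F\<^esub> h"
    have "M (\<Phi> (?k \<otimes>\<^bsub>F\<^esub> x)) \<le> M (\<Phi> ?k) + M (\<Phi> x)"
      using step by (simp add: fr_gen_closed expr_cost_closed H.norm_mult)
    also have "M (\<Phi> ?k) = M (\<Phi> (fr_gen g r))"
      using step by (simp add: fr_gen_closed H.norm_conj)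
    finally show ?case
      using gen[OF step.hyps(2), of r] step.IH by simp
  qed
qed

end

section \<open>The free product over integer vectors and real vectors\<close>

lemma group_real_group [simp]: "group real_group"
proof (rule groupI)
  show "\<exists>y\<in>carrier real_group. y \<otimes>\<^bsub>real_group\<^esub> x = \<one>\<^bsub>real_group\<^esub>" for x
    by (rule bexI[of _ "- x"]) (auto simp: real_group_def)
qed (auto simp: real_group_def)

lemma real_group_simps [simp]:
  "carrier real_group = UNIV" "\<one>\<^bsub>real_group\<^esub> = 0" "x \<otimes>\<^bsub>real_group\<^esub> y = x + y"
  by (auto simp: real_group_def)

lemma inv_real_group [simp]: "inv\<^bsub>real_group\<^esub> x = - x"
  by (rule group.inv_equality[OF group_real_group]) auto

lemma conj_inv_normed_real_vec_group:
  "conj_inv_normed_group (real_vec_group n) (real_L1_norm n)"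
proof -
  interpret G: group "real_vec_group n" by (simp add: real_vec_group_def)
  have inv: "inv\<^bsub>real_vec_group n\<^esub> x = (\<lambda>i\<in>{..<n}. - x i)" if "x \<in> carrier (real_vec_group n)" for x
    using that by (simp add: real_vec_group_def)
  show ?thesis
  proof
    fix x y assume x: "x \<in> carrier (real_vec_group n)" and y: "y \<in> carrier (real_vec_group n)"
    show "0 \<le> real_L1_norm n x" by (simp add: real_L1_norm_def sum_nonneg)
    show "real_L1_norm n x = 0 \<longleftrightarrow> x = \<one>\<^bsub>real_vec_group n\<^esub>"
      using x by (auto simp: real_L1_norm_def sum_nonneg_eq_0_iff real_vec_group_def fun_eq_iff
          PiE_def extensional_def)
    show "real_L1_norm n (inv\<^bsub>real_vec_group n\<^esub> x) = real_L1_norm n x"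
      using x by (simp add: inv real_L1_norm_def)
    show "real_L1_norm n (x \<otimes>\<^bsub>real_vec_group n\<^esub> y) \<le> real_L1_norm n x + real_L1_norm n y"
      by (simp add: real_L1_norm_def real_vec_group_def flip: sum.distrib) (intro sum_mono, auto)
    show "real_L1_norm n (y \<otimes>\<^bsub>real_vec_group n\<^esub> x \<otimes>\<^bsub>real_vec_group n\<^esub> inv\<^bsub>real_vec_group n\<^esub> y) = real_L1_norm n x"
      using y by (simp add: inv) (simp add: real_L1_norm_def real_vec_group_def)
  qed
qed

lemma int_vec_pow:
  assumes "g \<in> carrier (int_vec_group n)" "i < n"
  shows "(g [^]\<^bsub>int_vec_group n\<^esub> (k :: int)) i = k * g i"
proof -
  interpret group "int_vec_group n" by (simp add: int_vec_group_def)
  have nat: "(g [^]\<^bsub>int_vec_group n\<^esub> m) i = int m * g i" for m :: nat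
    using assms(2) by (induction m) (auto simp: int_vec_group_def algebra_simps)
  have "g [^]\<^bsub>int_vec_group n\<^esub> m \<in> carrier (int_vec_group n)" for m :: nat
    using assms(1) by simp
  then have inv: "(inv\<^bsub>int_vec_group n\<^esub> (g [^]\<^bsub>int_vec_group n\<^esub> m)) i = - (int m * g i)" for m :: nat
    using assms(2) nat[of m] by (simp add: int_vec_group_def)
  show ?thesis
  proof (cases k rule: int_cases2)
    case (nonneg m)
    then show ?thesis using nat[of m] by (simp add: int_pow_int)
  next
    case (nonpos m)
    then show ?thesis using inv[of m] assms(1) by (simp add: int_pow_neg_int)
  qed
qed

lemma subgroup_FG: "subgroup (carrier (FG S)) (FR S)"
  unfolding FG_def carrier_subgroup_generated
  by (rule group.generate_is_subgroup[OF group_FR]) simp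

lemma fr_gen_FG: "g \<in> S \<Longrightarrow> fr_gen g (of_int k) \<in> carrier (FG S)"
proof -
  assume g: "g \<in> S"
  interpret F: group "FR S" by (rule group_FR)
  interpret FG: subgroup "carrier (FG S)" "FR S" by (rule subgroup_FG)
  have "fr_gen g 1 \<in> generate (FR S) (carrier (FR S) \<inter> (\<lambda>g. fr_gen g 1) ` S)"
    by (rule generate.incl) (simp add: g fr_gen_closed)
  then have gen: "fr_gen g 1 \<in> carrier (FG S)"
    by (simp add: FG_def carrier_subgroup_generated)
  have nat: "fr_gen g (of_nat m) \<in> carrier (FG S)" for m
  proof (induction m)
    case 0
    show ?case using FG.one_closed by (simp add: fr_gen_0[of g S])
  next
    case (Suc m)
    show ?case
      using FG.m_closed[OF gen Suc] g by (simp add: fr_gen_add)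
  qed
  show ?thesis
  proof (cases k rule: int_cases2)
    case (nonneg m)
    then show ?thesis using nat[of m] by simp
  next
    case (nonpos m)
    then show ?thesis using FG.m_inv_closed[OF nat[of m]] g by (simp add: inv_fr_gen)
  qed
qed

locale int_vectors =
  fixes n :: nat
begin

abbreviation Zn :: "(nat \<Rightarrow> int) monoid" where "Zn \<equiv> int_vec_group n"
abbreviation Rn :: "(nat \<Rightarrow> real) monoid" where "Rn \<equiv> real_vec_group n"

sublocale Zn: conj_inv_normed_group Zn "int_L1_norm n"
  by (rule conj_inv_normed_int_vec_group)
sublocale Rn: conj_inv_normed_group Rn "real_L1_norm n"
  by (rule conj_inv_normed_real_vec_group)

abbreviation Fn :: "((nat \<Rightarrow> int) \<times> real) list monoid" where "Fn \<equiv> FR (carrier Zn)"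
abbreviation Fn_norm :: "((nat \<Rightarrow> int) \<times> real) list \<Rightarrow> real" where
  "Fn_norm \<equiv> fr_norm Zn (int_L1_norm n)"

sublocale Fn: conj_inv_pseudonormed_group Fn Fn_norm
  by (rule Zn.conj_inv_pseudonormed_FR)

text \<open>The homomorphism to \<open>\<real>\<^sup>n\<close> extending \<open>\<pi>\<close> to real exponents.\<close>

definition real_eval :: "((nat \<Rightarrow> int) \<times> real) list \<Rightarrow> nat \<Rightarrow> real" where
  "real_eval = fr_fold Rn (\<lambda>g r. \<lambda>i\<in>{..<n}. r * of_int (g i))"

lemma real_eval_hom: "real_eval \<in> hom Fn Rn"
proof (rule homI)
  fix x y assume "x \<in> carrier Fn" "y \<in> carrier Fn"
  then have xy: "x \<in> fr_words (carrier Zn)" "y \<in> fr_words (carrier Zn)" by (auto simp: FR_def)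
  show "real_eval x \<in> carrier Rn"
    using xy(1) unfolding real_eval_def fr_fold_def
  proof (induction x)
    case (Cons p v)
    then show ?case
      by (cases p) (auto simp: fr_words_Cons real_vec_group_def)
  qed auto
  show "real_eval (x \<otimes>\<^bsub>Fn\<^esub> y) = real_eval x \<otimes>\<^bsub>Rn\<^esub> real_eval y"
    unfolding real_eval_def
    by (rule fr_fold_mult(2)[where A = UNIV and S = "carrier Zn"])
      (auto simp: Rn.group_axioms real_vec_group_def distrib_right fun_eq_iff xy)
qed

sublocale real_eval: group_hom Fn Rn real_eval
  using real_eval_hom by unfold_locales

lemma real_eval_gen:
  "real_eval (fr_gen g r) = (\<lambda>i\<in>{..<n}. r * of_int (g i))"
  by (auto simp: real_eval_def fr_fold_def fr_gen_def real_vec_group_def fun_eq_iff)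

lemma real_eval_le_norm: "x \<in> carrier Fn \<Longrightarrow> real_L1_norm n (real_eval x) \<le> Fn_norm x"
  by (rule Zn.hom_norm_le_fr_norm[OF Rn.conj_inv_normed_group_axioms real_eval_hom])
    (auto simp: real_eval_gen real_L1_norm_def int_L1_norm_def sum_distrib_left abs_mult)

lemma real_eval_scale:
  assumes "x \<in> carrier Fn" "i < n"
  shows "real_eval (fr_scale (carrier Zn) t x) i = t * real_eval x i"
proof -
  interpret sc: group_hom Fn Fn "fr_scale (carrier Zn) t"
    using fr_scale_hom by unfold_locales
  show ?thesis
    using assms
  proof (induction x rule: FR_induct)
    case one
    then show ?case by (simp add: real_vec_group_def)
  next
    case (mult g r w)
    have "real_eval (fr_gen g r \<otimes>\<^bsub>Fn\<^esub> w) i = r * g i + real_eval w i" for r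
      using mult by (simp add: fr_gen_closed real_eval_gen) (simp add: real_vec_group_def)
    moreover have "real_eval (fr_gen g r \<otimes>\<^bsub>Fn\<^esub> fr_scale (carrier Zn) t w) i =
        r * g i + real_eval (fr_scale (carrier Zn) t w) i" for r
      using mult by (simp add: fr_gen_closed real_eval_gen) (simp add: real_vec_group_def)
    ultimately show ?case
      using mult by (simp add: fr_gen_closed fr_scale_gen algebra_simps)
  qed
qed

lemma real_eval_fg_eval:
  assumes "w \<in> carrier (FG (carrier Zn))" "i < n"
  shows "real_eval w i = of_int (fg_eval Zn w i)"
  using FG_int_words[OF assms(1)]
proof (induction w)
  case Nil
  then show ?case
    using assms(2) by (simp add: real_eval_def fg_eval_def fr_fold_def int_vec_group_def real_vec_group_def)
next
  case (Cons p w)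
  obtain g r where p: "p = (g, r)" by (cases p)
  have g: "g \<in> carrier Zn" "r \<in> \<int>" and IH: "real_eval w i = of_int (fg_eval Zn w i)"
    using Cons p by (auto simp: fr_words_Cons)
  have "real_eval (p # w) i = r * g i + real_eval w i"
    using assms(2) by (simp add: real_eval_def fr_fold_def p real_vec_group_def)
  moreover have "fg_eval Zn (p # w) = g [^]\<^bsub>Zn\<^esub> \<lfloor>r\<rfloor> \<otimes>\<^bsub>Zn\<^esub> fg_eval Zn w"
    by (simp add: fg_eval_def fr_fold_def p)
  then have "fg_eval Zn (p # w) i = (g [^]\<^bsub>Zn\<^esub> \<lfloor>r\<rfloor>) i + fg_eval Zn w i"
    using assms(2) by (simp add: int_vec_group_def)
  ultimately show ?case
    using IH g assms(2) by (auto simp: int_vec_pow elim!: Ints_cases)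
qed

definition basis_vec :: "nat \<Rightarrow> nat \<Rightarrow> int" where
  "basis_vec i = (\<lambda>j\<in>{..<n}. if j = i then 1 else 0)"

text \<open>
  For \<open>m = n\<close> this is a section of \<^const>\<open>real_eval\<close>. It preserves norms and, on integer
  arguments, lands in the free group. The partial products serve for induction.
\<close>

primrec axis_word :: "nat \<Rightarrow> (nat \<Rightarrow> real) \<Rightarrow> ((nat \<Rightarrow> int) \<times> real) list" where
  "axis_word 0 a = \<one>\<^bsub>Fn\<^esub>"
| "axis_word (Suc m) a = axis_word m a \<otimes>\<^bsub>Fn\<^esub> fr_gen (basis_vec m) (a m)"

lemma basis_vec_closed [simp]: "basis_vec i \<in> carrier Zn"
  by (simp add: basis_vec_def int_vec_group_def)

lemma basis_vec_norm: "i < n \<Longrightarrow> int_L1_norm n (basis_vec i) = 1"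
proof -
  assume "i < n"
  have "int_L1_norm n (basis_vec i) = (\<Sum>j<n. if j = i then 1 else 0)"
    unfolding int_L1_norm_def by (rule sum.cong) (auto simp: basis_vec_def)
  then show ?thesis using \<open>i < n\<close> by simp
qed

lemma axis_word_closed [simp]: "axis_word m a \<in> carrier Fn"
  by (induction m) (auto simp: fr_gen_closed)

lemma axis_word_scale: "fr_scale (carrier Zn) t (axis_word m a) = axis_word m (\<lambda>i. t * a i)"
proof -
  interpret sc: group_hom Fn Fn "fr_scale (carrier Zn) t"
    using fr_scale_hom by unfold_locales
  show ?thesis by (induction m) (auto simp: fr_gen_closed fr_scale_gen)
qed

lemma real_eval_axis_word: "i < n \<Longrightarrow> real_eval (axis_word m a) i = (if i < m then a i else 0)"
proof (induction m)
  case 0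
  then show ?case by (simp add: real_vec_group_def)
next
  case (Suc m)
  then have "real_eval (axis_word (Suc m) a) i =
      real_eval (axis_word m a) i + a m * basis_vec m i"
    by (simp add: fr_gen_closed real_eval_gen) (simp add: real_vec_group_def)
  then show ?case
    using Suc by (auto simp: basis_vec_def less_Suc_eq)
qed

lemma axis_word_dist_le:
  "m \<le> n \<Longrightarrow> Fn.dst (axis_word m a) (axis_word m b) \<le> (\<Sum>i<m. \<bar>a i - b i\<bar>)"
proof (induction m)
  case 0
  then show ?case by (simp add: group_dist_def Fn.pnorm_one)
next
  case (Suc m)
  have "Fn.dst (fr_gen (basis_vec m) (a m)) (fr_gen (basis_vec m) (b m)) \<le> \<bar>a m - b m\<bar>"
    using Zn.fr_norm_gen_le[of "basis_vec m" "b m - a m"] Suc.prems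
    by (simp add: group_dist_def inv_fr_gen fr_gen_add basis_vec_norm abs_minus_commute)
  then show ?case
    using Fn.dst_mult_le[of "axis_word m a" "axis_word m b" "fr_gen (basis_vec m) (a m)"
        "fr_gen (basis_vec m) (b m)"] Suc
    by (simp add: fr_gen_closed)
qed

lemma axis_word_zero: "axis_word m (\<lambda>_. 0) = \<one>\<^bsub>Fn\<^esub>"
  by (induction m) (auto simp: fr_gen_0[of _ "carrier Zn"])

text \<open>
  The syllables cost at most the sum of the coordinates, and by the 1-Lipschitz map
  \<^const>\<open>real_eval\<close> no expression is cheaper.
\<close>

lemma axis_word_norm: "Fn_norm (axis_word n a) = real_L1_norm n a"
proof (rule antisym)
  show "Fn_norm (axis_word n a) \<le> real_L1_norm n a"
    using axis_word_dist_le[of n "\<lambda>_. 0" a]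
    by (simp add: axis_word_zero group_dist_def real_L1_norm_def)
  show "real_L1_norm n a \<le> Fn_norm (axis_word n a)"
    using real_eval_le_norm[of "axis_word n a"]
    by (simp add: real_L1_norm_def real_eval_axis_word)
qed

lemma axis_word_FG: "axis_word m (\<lambda>i. of_int (a i)) \<in> carrier (FG (carrier Zn))"
proof -
  interpret FG: subgroup "carrier (FG (carrier Zn))" Fn by (rule subgroup_FG)
  show ?thesis
    by (induction m) (simp_all add: FG.one_closed FG.m_closed fr_gen_FG)
qed

end

section \<open>Asymptotic directions\<close>

abbreviation along :: "real set \<Rightarrow> real filter" where
  "along T \<equiv> inf at_top (principal T)"

lemma eventually_along: "eventually P (along T) \<longleftrightarrow> (\<exists>t0. \<forall>t\<in>T. t0 \<le> t \<longrightarrow> P t)"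
  by (auto simp: eventually_inf_principal eventually_at_top_linorder)

lemma eventually_along_mem: "eventually (\<lambda>t. t \<in> T) (along T)"
  by (auto simp: eventually_along)

lemma along_neq_bot:
  assumes "scaling_set T"
  shows "along T \<noteq> bot"
proof
  assume "along T = bot"
  then have "eventually (\<lambda>_. False) (along T)" by simp
  then obtain t0 where "\<forall>t\<in>T. t < t0" by (auto simp: eventually_along not_le)
  then have "T \<subseteq> {0..t0}" using assms by (force simp: scaling_set_def)
  then show False
    using assms bounded_subset[OF bounded_closed_interval] by (auto simp: scaling_set_def)
qed

lemma scaling_set_pos: "scaling_set T \<Longrightarrow> t \<in> T \<Longrightarrow> 0 < t"
  by (auto simp: scaling_set_def)

lemma along_at_top: "filterlim (\<lambda>t. t) at_top (along T)"
  using filterlim_mono[OF filterlim_ident[of at_top] order_refl inf_le1] .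

lemma Cauchy_along_convergent:
  fixes f :: "real \<Rightarrow> real"
  assumes "scaling_set T"
    and "\<And>\<epsilon>. \<epsilon> > 0 \<Longrightarrow> \<exists>t0. \<forall>t\<in>T. \<forall>t'\<in>T. t0 \<le> t \<longrightarrow> t0 \<le> t' \<longrightarrow> \<bar>f t - f t'\<bar> < \<epsilon>"
  obtains l where "(f \<longlongrightarrow> l) (along T)"
proof -
  have "cauchy_filter (filtermap f (along T))"
    unfolding cauchy_filter_metric_filtermap
  proof (intro allI impI)
    fix e :: real assume "e > 0"
    then obtain t0 where "\<forall>t\<in>T. \<forall>t'\<in>T. t0 \<le> t \<longrightarrow> t0 \<le> t' \<longrightarrow> \<bar>f t - f t'\<bar> < e"
      using assms(2) by blast
    then show "\<exists>P. eventually P (along T) \<and> (\<forall>x y. P x \<and> P y \<longrightarrow> dist (f x) (f y) < e)"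
      by (intro exI[of _ "\<lambda>t. t \<in> T \<and> t0 \<le> t"]) (auto simp: eventually_along dist_real_def)
  qed
  moreover have "filtermap f (along T) \<noteq> bot"
    using along_neq_bot[OF assms(1)] by (simp add: filtermap_bot_iff)
  ultimately obtain l where "filtermap f (along T) \<le> nhds l"
    using complete_uniform[of "UNIV :: real set"] complete_UNIV by auto
  then show ?thesis
    using that by (simp add: filterlim_def)
qed

lemma tendsto_floor_div:
  fixes a :: real
  assumes "filterlim s at_top F"
  shows "((\<lambda>t. of_int \<lfloor>s t * a\<rfloor> / s t) \<longlongrightarrow> a) F"
proof (rule LIM_zero_cancel, rule Lim_null_comparison)
  show "eventually (\<lambda>t. norm (of_int \<lfloor>s t * a\<rfloor> / s t - a) \<le> 1 / s t) F"
    using filterlim_at_top_dense[THEN iffD1, OF assms, rule_format, of 0]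
  proof eventually_elim
    case (elim t)
    have "\<bar>of_int \<lfloor>s t * a\<rfloor> - s t * a\<bar> \<le> 1" by linarith
    moreover have "of_int \<lfloor>s t * a\<rfloor> / s t - a = (of_int \<lfloor>s t * a\<rfloor> - s t * a) / s t"
      using elim by (simp add: field_simps)
    ultimately show ?case
      using elim by (simp add: divide_right_mono)
  qed
  show "((\<lambda>t. 1 / s t) \<longlongrightarrow> 0) F"
    using tendsto_inverse_0_at_top[OF assms] by (simp add: field_simps)
qed

context int_vectors
begin

text \<open>
  A family \<open>g\<close> of integer vectors, read at scale \<open>s\<close> along a filter. The two cones use the
  same notion: one with the elements of a scaling set as their own scales, the other with a
  scaling sequence along an ultrafilter.
\<close>

definition has_direction :: "'i filter \<Rightarrow> ('i \<Rightarrow> real) \<Rightarrow> ('i \<Rightarrow> nat \<Rightarrow> int) \<Rightarrow> (nat \<Rightarrow> real) \<Rightarrow> bool" where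
  "has_direction F s g v \<longleftrightarrow> (\<forall>i<n. ((\<lambda>t. of_int (g t i) / s t) \<longlongrightarrow> v i) F)"

definition direction :: "'i filter \<Rightarrow> ('i \<Rightarrow> real) \<Rightarrow> ('i \<Rightarrow> nat \<Rightarrow> int) \<Rightarrow> nat \<Rightarrow> real" where
  "direction F s g = (\<lambda>i\<in>{..<n}. Lim F (\<lambda>t. of_int (g t i) / s t))"

lemma direction_closed: "direction F s g \<in> carrier Rn"
  by (simp add: direction_def real_vec_group_def)

lemma direction_nth: "has_direction F s g v \<Longrightarrow> F \<noteq> bot \<Longrightarrow> i < n \<Longrightarrow> direction F s g i = v i"
  by (auto simp: direction_def has_direction_def intro!: tendsto_Lim)

lemma has_direction_direction:
  "has_direction F s g v \<Longrightarrow> F \<noteq> bot \<Longrightarrow> has_direction F s g (direction F s g)"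
  using direction_nth by (fastforce simp: has_direction_def)

lemma vec_eqI:
  assumes "v \<in> carrier Rn" "w \<in> carrier Rn" "\<And>i. i < n \<Longrightarrow> v i = w i"
  shows "v = w"
  using assms unfolding real_vec_group_def carrier_product_group
  by (intro PiE_ext[of v "{..<n}"]) auto

lemma direction_eqI:
  assumes "has_direction F s g v" "F \<noteq> bot" "v \<in> carrier Rn"
  shows "direction F s g = v"
  using direction_closed assms(3) direction_nth[OF assms(1,2)] by (rule vec_eqI)

lemma has_direction_cong:
  assumes "has_direction F s g v" "eventually (\<lambda>t. h t = g t) F"
  shows "has_direction F s h v"
  unfolding has_direction_def
proof (intro allI impI)
  fix i assume "i < n"
  then have "((\<lambda>t. of_int (g t i) / s t) \<longlongrightarrow> v i) F"
    using assms(1) by (simp add: has_direction_def)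
  then show "((\<lambda>t. of_int (h t i) / s t) \<longlongrightarrow> v i) F"
    by (rule Lim_transform_eventually) (use assms(2) in \<open>auto elim: eventually_mono\<close>)
qed

lemma has_direction_compose:
  "has_direction F s g v \<Longrightarrow> filterlim d F E \<Longrightarrow> has_direction E (\<lambda>k. s (d k)) (\<lambda>k. g (d k)) v"
  using filterlim_compose[of "\<lambda>t. of_int (g t _) / s t" _ F d E] by (simp add: has_direction_def)

lemma has_direction_mono: "has_direction F s g v \<Longrightarrow> E \<le> F \<Longrightarrow> has_direction E s g v"
  unfolding has_direction_def by (auto intro: tendsto_mono[of E F])

lemma has_direction_mult:
  "has_direction F s g v \<Longrightarrow> has_direction F s h w \<Longrightarrow>
    has_direction F s (\<lambda>t. g t \<otimes>\<^bsub>Zn\<^esub> h t) (v \<otimes>\<^bsub>Rn\<^esub> w)"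
  by (auto simp: has_direction_def int_vec_group_def real_vec_group_def add_divide_distrib
      intro!: tendsto_add)

lemma inv_Zn: "x \<in> carrier Zn \<Longrightarrow> inv\<^bsub>Zn\<^esub> x = (\<lambda>i\<in>{..<n}. - x i)"
  by (simp add: int_vec_group_def)

lemma inv_Rn: "x \<in> carrier Rn \<Longrightarrow> inv\<^bsub>Rn\<^esub> x = (\<lambda>i\<in>{..<n}. - x i)"
  by (simp add: real_vec_group_def)

lemma has_direction_inv:
  assumes "has_direction F s g v" "eventually (\<lambda>t. g t \<in> carrier Zn) F" "v \<in> carrier Rn"
  shows "has_direction F s (\<lambda>t. inv\<^bsub>Zn\<^esub> (g t)) (inv\<^bsub>Rn\<^esub> v)"
proof (rule has_direction_cong)
  show "has_direction F s (\<lambda>t. \<lambda>i\<in>{..<n}. - g t i) (inv\<^bsub>Rn\<^esub> v)"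
    using assms by (auto simp: has_direction_def inv_Rn intro: tendsto_minus)
  show "eventually (\<lambda>t. inv\<^bsub>Zn\<^esub> (g t) = (\<lambda>i\<in>{..<n}. - g t i)) F"
    using assms(2) by eventually_elim (simp add: inv_Zn)
qed

lemma has_direction_norm:
  assumes "has_direction F s g v" "eventually (\<lambda>t. s t > 0) F"
  shows "((\<lambda>t. int_L1_norm n (g t) / s t) \<longlongrightarrow> real_L1_norm n v) F"
proof (rule Lim_transform_eventually)
  show "((\<lambda>t. \<Sum>i<n. \<bar>of_int (g t i) / s t\<bar>) \<longlongrightarrow> real_L1_norm n v) F"
    using assms(1) unfolding real_L1_norm_def has_direction_def
    by (intro tendsto_sum tendsto_rabs) auto
  show "eventually (\<lambda>t. (\<Sum>i<n. \<bar>of_int (g t i) / s t\<bar>) = int_L1_norm n (g t) / s t) F"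
    using assms(2) by eventually_elim (simp add: int_L1_norm_def sum_divide_distrib abs_divide)
qed

definition floor_vec :: "real \<Rightarrow> (nat \<Rightarrow> real) \<Rightarrow> nat \<Rightarrow> int" where
  "floor_vec t v = (\<lambda>i\<in>{..<n}. \<lfloor>t * v i\<rfloor>)"

lemma floor_vec_closed [simp]: "floor_vec t v \<in> carrier Zn"
  by (simp add: floor_vec_def int_vec_group_def)

lemma has_direction_floor_vec:
  "filterlim s at_top F \<Longrightarrow> has_direction F s (\<lambda>t. floor_vec (s t) v) v"
  by (simp add: has_direction_def floor_vec_def tendsto_floor_div)

text \<open>
  Both cones are quotients of groups of families that have a direction, under a norm which
  is the \<open>L\<^sup>1\<close>-norm of the direction; here \<open>C\<close> is that group of families. The families \<open>t \<mapsto> \<lfloor>s t \<cdot> v\<rfloor>\<close> make every vector a direction.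
\<close>

lemma norm_presentation_directions:
  assumes F: "F \<noteq> bot" "eventually (\<lambda>t. t \<in> I) F" and s: "filterlim s at_top F"
    and C: "subgroup C (product_group I (\<lambda>_. Zn))"
    and dir: "\<And>g. g \<in> C \<Longrightarrow> \<exists>v. has_direction F s g v"
    and fl: "\<And>v. v \<in> carrier Rn \<Longrightarrow> (\<lambda>t\<in>I. floor_vec (s t) v) \<in> C"
    and Q: "\<And>g. g \<in> C \<Longrightarrow> Q g = real_L1_norm n (direction F s g)"
  shows "norm_presentation ((product_group I (\<lambda>_. Zn))\<lparr>carrier := C\<rparr>) Rn (direction F s) (real_L1_norm n) Q"
proof -
  let ?P = "product_group I (\<lambda>_. Zn)"
  interpret P: group ?P by (simp add: Zn.group_axioms)
  have d: "has_direction F s g (direction F s g)" if "g \<in> C" for g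
    using dir[OF that] has_direction_direction F(1) by blast
  have mult: "direction F s (\<lambda>t\<in>I. g t \<otimes>\<^bsub>Zn\<^esub> h t) = direction F s g \<otimes>\<^bsub>Rn\<^esub> direction F s h"
    if "g \<in> C" "h \<in> C" for g h
  proof (rule direction_eqI[OF has_direction_cong[OF has_direction_mult[OF d d]]])
    show "eventually (\<lambda>t. (\<lambda>t\<in>I. g t \<otimes>\<^bsub>Zn\<^esub> h t) t = g t \<otimes>\<^bsub>Zn\<^esub> h t) F"
      using F(2) by eventually_elim simp
  qed (use that F direction_closed in auto)
  have onto: "v \<in> direction F s ` C" if v: "v \<in> carrier Rn" for v
  proof -
    have "has_direction F s (\<lambda>t\<in>I. floor_vec (s t) v) v"
      using F(2) by (intro has_direction_cong[OF has_direction_floor_vec[OF s]]) (auto elim: eventually_mono)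
    then have "direction F s (\<lambda>t\<in>I. floor_vec (s t) v) = v"
      using F(1) v by (rule direction_eqI)
    then show ?thesis using fl[OF v] by force
  qed
  interpret A: group "?P\<lparr>carrier := C\<rparr>"
    by (rule P.subgroup_imp_group[OF C])
  show ?thesis
  proof unfold_locales
    show "direction F s \<in> hom (?P\<lparr>carrier := C\<rparr>) Rn"
      by (rule homI) (simp_all add: direction_closed mult)
    show "direction F s ` carrier (?P\<lparr>carrier := C\<rparr>) = carrier Rn"
      using onto direction_closed by auto
  qed (simp add: Q)
qed

end

section \<open>The directional cone of the integer vectors\<close>

context conj_inv_normed_group
begin

lemma fr_Cauchy_of_limit:
  assumes x: "x \<in> carrier F" and f: "\<And>t. t \<in> T \<Longrightarrow> f t \<in> carrier F"
    and lim: "((\<lambda>t. group_dist F (fr_norm G N) x (f t)) \<longlongrightarrow> 0) (along T)"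
  shows "fr_Cauchy G N T f" and "((\<lambda>t. fr_norm G N (f t)) \<longlongrightarrow> fr_norm G N x) (along T)"
proof -
  interpret FR: conj_inv_pseudonormed_group F "fr_norm G N" by (rule conj_inv_pseudonormed_FR)
  show "fr_Cauchy G N T f"
    unfolding fr_Cauchy_def
  proof (intro allI impI)
    fix e :: real assume "e > 0"
    then have "eventually (\<lambda>t. FR.dst x (f t) < e / 2) (along T)"
      using order_tendstoD(2)[OF lim, of "e / 2"] by simp
    then obtain t0 where t0: "\<And>t. t \<in> T \<Longrightarrow> t0 \<le> t \<Longrightarrow> FR.dst x (f t) < e / 2"
      by (auto simp: eventually_along)
    have "FR.dst (f t) (f t') < e" if "t \<in> T" "t' \<in> T" "t0 \<le> t" "t0 \<le> t'" for t t'
      using FR.dst_triangle[of "f t" x "f t'"] FR.dst_commute[of x "f t"] x f that t0[of t] t0[of t']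
      by simp
    then show "\<exists>t0. \<forall>t\<in>T. \<forall>t'\<in>T. t0 \<le> t \<longrightarrow> t0 \<le> t' \<longrightarrow> FR.dst (f t) (f t') < e"
      by blast
  qed
  have "eventually (\<lambda>t. norm (fr_norm G N (f t) - fr_norm G N x) \<le> FR.dst x (f t)) (along T)"
    using eventually_along_mem[of T]
  proof eventually_elim
    case (elim t)
    then show ?case
      using FR.abs_norm_diff_le[OF x f, of t] by (simp add: abs_minus_commute)
  qed
  then show "((\<lambda>t. fr_norm G N (f t)) \<longlongrightarrow> fr_norm G N x) (along T)"
    by (rule LIM_zero_cancel[OF Lim_null_comparison[OF _ lim]])
qed

text \<open>
  Serves for the coordinates of the rescaled family, and for the pseudonorm itself, so that the
  limit in the definition of \<^const>\<open>DG_norm\<close> exists.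
\<close>

lemma fr_Cauchy_convergent:
  fixes \<phi> :: "('a \<times> real) list \<Rightarrow> real"
  assumes T: "scaling_set T" and "fr_Cauchy G N T f" and f: "\<And>t. t \<in> T \<Longrightarrow> f t \<in> carrier F"
    and \<phi>: "\<And>x y. x \<in> carrier F \<Longrightarrow> y \<in> carrier F \<Longrightarrow>
      \<bar>\<phi> x - \<phi> y\<bar> \<le> group_dist F (fr_norm G N) x y"
  obtains l where "((\<lambda>t. \<phi> (f t)) \<longlongrightarrow> l) (along T)"
proof (rule Cauchy_along_convergent[OF T])
  fix e :: real assume "e > 0"
  then obtain t0 where "\<forall>t\<in>T. \<forall>t'\<in>T. t0 \<le> t \<longrightarrow> t0 \<le> t' \<longrightarrow> group_dist F (fr_norm G N) (f t) (f t') < e"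
    using assms(2) unfolding fr_Cauchy_def by blast
  then show "\<exists>t0. \<forall>t\<in>T. \<forall>t'\<in>T. t0 \<le> t \<longrightarrow> t0 \<le> t' \<longrightarrow> \<bar>\<phi> (f t) - \<phi> (f t')\<bar> < e"
    using \<phi> f by (meson order_le_less_trans)
qed (rule that)

end

context int_vectors
begin

abbreviation rescaled :: "(real \<Rightarrow> ((nat \<Rightarrow> int) \<times> real) list) \<Rightarrow> real \<Rightarrow> ((nat \<Rightarrow> int) \<times> real) list" where
  "rescaled w t \<equiv> fr_scale (carrier Zn) (1 / t) (w t)"

lemma FG_closed: "x \<in> carrier (FG (carrier Zn)) \<Longrightarrow> x \<in> carrier Fn"
  using subgroup.mem_carrier[OF subgroup_FG] .

lemma fr_scale_closed: "x \<in> carrier Fn \<Longrightarrow> fr_scale (carrier Zn) t x \<in> carrier Fn"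
  using fr_scale_hom by (rule hom_in_carrier)

lemma fg_eval_closed: "x \<in> carrier (FG (carrier Zn)) \<Longrightarrow> fg_eval Zn x \<in> carrier Zn"
  using fg_eval_hom[OF Zn.group_axioms] by (rule hom_in_carrier)

lemma carrier_DG: "carrier (DG Zn (int_L1_norm n) T) =
    {w \<in> T \<rightarrow>\<^sub>E carrier (FG (carrier Zn)). fr_Cauchy Zn (int_L1_norm n) T (rescaled w)}"
  by (simp add: DG_def)

lemma real_eval_coord_le:
  assumes "x \<in> carrier Fn" "y \<in> carrier Fn" "i < n"
  shows "\<bar>real_eval x i - real_eval y i\<bar> \<le> Fn.dst x y"
proof -
  have "real_eval (inv\<^bsub>Fn\<^esub> x \<otimes>\<^bsub>Fn\<^esub> y) i = real_eval y i - real_eval x i"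
    using assms inv_Rn[of "real_eval x"] by (simp) (simp add: real_vec_group_def)
  then have "\<bar>real_eval x i - real_eval y i\<bar> = \<bar>real_eval (inv\<^bsub>Fn\<^esub> x \<otimes>\<^bsub>Fn\<^esub> y) i\<bar>"
    by simp
  also have "\<dots> \<le> real_L1_norm n (real_eval (inv\<^bsub>Fn\<^esub> x \<otimes>\<^bsub>Fn\<^esub> y))"
    unfolding real_L1_norm_def using assms(3) by (intro member_le_sum) auto
  also have "\<dots> \<le> Fn.dst x y"
    unfolding group_dist_def using assms by (intro real_eval_le_norm) simp
  finally show ?thesis .
qed

text \<open>
  The 1-Lipschitz map \<^const>\<open>real_eval\<close> sends the rescaled lift to the rescaled family itself;
  so the family converges, and its limit is no longer than the lift.
\<close>

lemma DG_direction:
  assumes T: "scaling_set T" and w: "w \<in> carrier (DG Zn (int_L1_norm n) T)"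
  defines "g \<equiv> compose T (fg_eval Zn) w"
  shows "\<exists>v. has_direction (along T) (\<lambda>t. t) g v"
    and "has_direction (along T) (\<lambda>t. t) g v \<Longrightarrow> real_L1_norm n v \<le> DG_norm Zn (int_L1_norm n) T w"
proof -
  have wFG: "w t \<in> carrier (FG (carrier Zn))" if "t \<in> T" for t
    using w that by (auto simp: carrier_DG)
  then have u: "rescaled w t \<in> carrier Fn" if "t \<in> T" for t
    using that by (intro fr_scale_closed FG_closed)
  have C: "fr_Cauchy Zn (int_L1_norm n) T (rescaled w)"
    using w by (simp add: carrier_DG)
  have coord: "real_eval (rescaled w t) i = of_int (g t i) / t" if "t \<in> T" "i < n" for t i
    using that wFG[OF that(1)]
    by (simp add: g_def compose_def real_eval_scale FG_closed real_eval_fg_eval)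
  have "\<exists>l. ((\<lambda>t. of_int (g t i) / t) \<longlongrightarrow> l) (along T)" if i: "i < n" for i
  proof -
    obtain l where l: "((\<lambda>t. real_eval (rescaled w t) i) \<longlongrightarrow> l) (along T)"
      by (rule Zn.fr_Cauchy_convergent[OF T C, of "\<lambda>x. real_eval x i"])
        (use u real_eval_coord_le i in auto)
    have "eventually (\<lambda>t. real_eval (rescaled w t) i = of_int (g t i) / t) (along T)"
      using coord i by (auto simp: eventually_along)
    then show ?thesis by (intro exI) (rule Lim_transform_eventually[OF l])
  qed
  then show "\<exists>v. has_direction (along T) (\<lambda>t. t) g v"
    unfolding has_direction_def by metis
  assume v: "has_direction (along T) (\<lambda>t. t) g v"
  obtain c where c: "((\<lambda>t. Fn_norm (rescaled w t)) \<longlongrightarrow> c) (along T)"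
    by (rule Zn.fr_Cauchy_convergent[OF T C, of Fn_norm]) (use u Fn.abs_norm_diff_le in auto)
  have "real_L1_norm n v \<le> c"
  proof (rule tendsto_le[OF along_neq_bot[OF T] c has_direction_norm[OF v]])
    show "eventually (\<lambda>t. 0 < t) (along T)"
      using scaling_set_pos[OF T] by (auto simp: eventually_along)
    show "eventually (\<lambda>t. int_L1_norm n (g t) / t \<le> Fn_norm (rescaled w t)) (along T)"
      using eventually_along_mem[of T]
    proof eventually_elim
      case (elim t)
      have "int_L1_norm n (g t) / t = real_L1_norm n (real_eval (rescaled w t))"
        using scaling_set_pos[OF T elim]
        by (simp add: int_L1_norm_def real_L1_norm_def coord[OF elim] sum_divide_distrib abs_divide)
      then show ?case using real_eval_le_norm[OF u[OF elim]] by simp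
    qed
  qed
  then show "real_L1_norm n v \<le> DG_norm Zn (int_L1_norm n) T w"
    using tendsto_Lim[OF along_neq_bot[OF T] c] by (simp add: DG_norm_def)
qed

text \<open>
  Conversely, round \<open>t \<cdot> v\<close> down, lift the result along the coordinate axes, and append a single
  letter \<open>h t\<close> for the difference from \<open>g t\<close>. After rescaling, that letter costs
  \<open>\<parallel>h t\<parallel> / t\<close>, which tends to \<open>0\<close> since \<open>g t / t\<close> tends to \<open>v\<close>, and the rest tends to the
  image of \<open>v\<close> under the norm-preserving section \<^const>\<open>axis_word\<close>.
\<close>

lemma DG_lift:
  assumes T: "scaling_set T" and g: "g \<in> T \<rightarrow>\<^sub>E carrier Zn" and v: "has_direction (along T) (\<lambda>t. t) g v"
  obtains w where "w \<in> carrier (DG Zn (int_L1_norm n) T)" "compose T (fg_eval Zn) w = g"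
    "DG_norm Zn (int_L1_norm n) T w = real_L1_norm n v"
proof -
  define h where "h t = (\<lambda>i\<in>{..<n}. g t i - \<lfloor>t * v i\<rfloor>)" for t
  define w where "w = (\<lambda>t\<in>T. axis_word n (\<lambda>i. of_int \<lfloor>t * v i\<rfloor>) \<otimes>\<^bsub>Fn\<^esub> fr_gen (h t) 1)"
  interpret FG: subgroup "carrier (FG (carrier Zn))" Fn by (rule subgroup_FG)
  have h: "h t \<in> carrier Zn" for t
    by (simp add: h_def int_vec_group_def)
  have wFG: "w t \<in> carrier (FG (carrier Zn))" if "t \<in> T" for t
    using that axis_word_FG[of n "\<lambda>i. \<lfloor>t * v i\<rfloor>"] fr_gen_FG[OF h, of t 1] by (simp add: w_def)
  have eval: "compose T (fg_eval Zn) w = g"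
  proof (rule extensionalityI[of _ T])
    fix t assume t: "t \<in> T"
    have "fg_eval Zn (w t) = g t"
    proof (rule PiE_ext[of _ "{..<n}" "\<lambda>_. UNIV"])
      show "fg_eval Zn (w t) \<in> {..<n} \<rightarrow>\<^sub>E UNIV"
        using fg_eval_closed[OF wFG[OF t]] by (simp add: int_vec_group_def)
      show "g t \<in> {..<n} \<rightarrow>\<^sub>E UNIV"
        using g t by (auto simp: int_vec_group_def)
      fix i assume "i \<in> {..<n}"
      then have i: "i < n" by simp
      have "real_of_int (fg_eval Zn (w t) i) = real_eval (w t) i"
        using real_eval_fg_eval[OF wFG[OF t] i] by simp
      also have "\<dots> = (real_eval (axis_word n (\<lambda>i. of_int \<lfloor>t * v i\<rfloor>)) \<otimes>\<^bsub>Rn\<^esub> real_eval (fr_gen (h t) 1)) i"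
        using t h by (simp add: w_def fr_gen_closed)
      also have "\<dots> = of_int (g t i)"
        using i real_eval_axis_word[OF i, of n "\<lambda>i. of_int \<lfloor>t * v i\<rfloor>"]
        by (simp add: real_vec_group_def real_eval_gen h_def)
      finally show "fg_eval Zn (w t) i = g t i" by simp
    qed
    then show "compose T (fg_eval Zn) w t = g t"
      using t by (simp add: compose_def)
  qed (use g in \<open>auto simp: compose_def PiE_def\<close>)
  have u: "rescaled w t = axis_word n (\<lambda>i. of_int \<lfloor>t * v i\<rfloor> / t) \<otimes>\<^bsub>Fn\<^esub> fr_gen (h t) (1 / t)"
    if "t \<in> T" for t
  proof -
    interpret sc: group_hom Fn Fn "fr_scale (carrier Zn) (1 / t)"
      using fr_scale_hom by unfold_locales
    show ?thesis
      using that h by (simp add: w_def fr_gen_closed fr_scale_gen axis_word_scale)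
  qed
  have "((\<lambda>t. Fn.dst (axis_word n v) (rescaled w t)) \<longlongrightarrow> 0) (along T)"
  proof (rule Lim_null_comparison)
    let ?b = "\<lambda>t. (\<Sum>i<n. \<bar>v i - of_int \<lfloor>t * v i\<rfloor> / t\<bar>) +
      (\<Sum>i<n. \<bar>of_int (g t i) / t - of_int \<lfloor>t * v i\<rfloor> / t\<bar>)"
    show "eventually (\<lambda>t. norm (Fn.dst (axis_word n v) (rescaled w t)) \<le> ?b t) (along T)"
      using eventually_along_mem[of T]
    proof eventually_elim
      case (elim t)
      have t: "0 < t" using scaling_set_pos[OF T elim] .
      let ?a = "axis_word n (\<lambda>i. of_int \<lfloor>t * v i\<rfloor> / t)"
      have "Fn.dst (axis_word n v) (rescaled w t) \<le>
          Fn.dst (axis_word n v) ?a + Fn.dst \<one>\<^bsub>Fn\<^esub> (fr_gen (h t) (1 / t))"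
        using Fn.dst_mult_le[of "axis_word n v" ?a "\<one>\<^bsub>Fn\<^esub>" "fr_gen (h t) (1 / t)"] h
        by (simp add: u[OF elim] fr_gen_closed)
      moreover have "Fn.dst (axis_word n v) ?a \<le> (\<Sum>i<n. \<bar>v i - of_int \<lfloor>t * v i\<rfloor> / t\<bar>)"
        by (rule axis_word_dist_le) simp
      moreover have "Fn.dst \<one>\<^bsub>Fn\<^esub> (fr_gen (h t) (1 / t)) \<le> 1 / t * int_L1_norm n (h t)"
        using Zn.fr_norm_gen_le[OF h[of t], of "1 / t"] t h by (simp add: group_dist_def fr_gen_closed)
      moreover have "1 / t * int_L1_norm n (h t) =
          (\<Sum>i<n. \<bar>of_int (g t i) / t - of_int \<lfloor>t * v i\<rfloor> / t\<bar>)"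
        using t by (simp add: int_L1_norm_def h_def sum_divide_distrib abs_divide flip: diff_divide_distrib)
      moreover have "0 \<le> Fn.dst (axis_word n v) (rescaled w t)"
        using wFG[OF elim] unfolding group_dist_def
        by (intro Fn.pnorm_nonneg) (simp add: fr_scale_closed FG_closed)
      ultimately show ?case by simp
    qed
    have "((\<lambda>t. of_int \<lfloor>t * v i\<rfloor> / t) \<longlongrightarrow> v i) (along T)" for i
      by (rule tendsto_floor_div[OF along_at_top])
    moreover have "((\<lambda>t. of_int (g t i) / t) \<longlongrightarrow> v i) (along T)" if "i < n" for i
      using v that by (simp add: has_direction_def)
    ultimately have "(?b \<longlongrightarrow> (\<Sum>i<n. \<bar>v i - v i\<bar>) + (\<Sum>i<n. \<bar>v i - v i\<bar>)) (along T)"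
      by (intro tendsto_add tendsto_sum tendsto_rabs tendsto_diff tendsto_const) auto
    then show "(?b \<longlongrightarrow> 0) (along T)" by simp
  qed
  then have C: "fr_Cauchy Zn (int_L1_norm n) T (rescaled w)"
    and lim: "((\<lambda>t. Fn_norm (rescaled w t)) \<longlongrightarrow> Fn_norm (axis_word n v)) (along T)"
    using Zn.fr_Cauchy_of_limit[OF axis_word_closed, of T "rescaled w" n v] wFG
    by (simp_all add: fr_scale_closed FG_closed)
  have "w \<in> carrier (DG Zn (int_L1_norm n) T)"
    using C wFG by (simp add: carrier_DG) (simp add: w_def)
  moreover have "DG_norm Zn (int_L1_norm n) T w = real_L1_norm n v"
    unfolding DG_norm_def axis_word_norm[symmetric] by (rule tendsto_Lim[OF along_neq_bot[OF T] lim])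
  ultimately show ?thesis using that eval by blast
qed

lemma carrier_CG:
  assumes "scaling_set T"
  shows "carrier (CG Zn (int_L1_norm n) T) =
    {g \<in> T \<rightarrow>\<^sub>E carrier Zn. \<exists>v. has_direction (along T) (\<lambda>t. t) g v}"
proof -
  have "compose T (fg_eval Zn) w \<in> T \<rightarrow>\<^sub>E carrier Zn" if "w \<in> carrier (DG Zn (int_L1_norm n) T)" for w
    using that by (auto simp: carrier_DG compose_def intro: fg_eval_closed)
  then show ?thesis
    using DG_direction(1)[OF assms] DG_lift[OF assms]
    by (auto simp: CG_def) (metis)
qed

lemma CG_norm_eq:
  assumes T: "scaling_set T" and g: "g \<in> carrier (CG Zn (int_L1_norm n) T)"
  shows "CG_norm Zn (int_L1_norm n) T g = real_L1_norm n (direction (along T) (\<lambda>t. t) g)"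
proof -
  have d: "has_direction (along T) (\<lambda>t. t) g (direction (along T) (\<lambda>t. t) g)"
    using g has_direction_direction[OF _ along_neq_bot[OF T]] by (auto simp: carrier_CG[OF T])
  obtain w where w: "w \<in> carrier (DG Zn (int_L1_norm n) T)" "compose T (fg_eval Zn) w = g"
    "DG_norm Zn (int_L1_norm n) T w = real_L1_norm n (direction (along T) (\<lambda>t. t) g)"
    using DG_lift[OF T _ d] g by (auto simp: carrier_CG[OF T])
  show ?thesis
    unfolding CG_norm_def
  proof (rule cInf_eq_minimum)
    show "real_L1_norm n (direction (along T) (\<lambda>t. t) g) \<in>
        {DG_norm Zn (int_L1_norm n) T w | w. w \<in> carrier (DG Zn (int_L1_norm n) T) \<and> compose T (fg_eval Zn) w = g}"
      using w by force
  qed (use DG_direction(2)[OF T] d in blast)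
qed

theorem norm_presentation_CG:
  assumes T: "scaling_set T"
  shows "norm_presentation (CG Zn (int_L1_norm n) T) Rn (direction (along T) (\<lambda>t. t)) (real_L1_norm n)
    (CG_norm Zn (int_L1_norm n) T)"
proof -
  let ?P = "product_group T (\<lambda>_. Zn)" and ?C = "carrier (CG Zn (int_L1_norm n) T)"
  interpret P: group ?P by (simp add: Zn.group_axioms)
  have fl: "(\<lambda>t\<in>T. floor_vec t v) \<in> ?C" for v
  proof -
    have "has_direction (along T) (\<lambda>t. t) (\<lambda>t\<in>T. floor_vec t v) v"
      by (rule has_direction_cong[OF has_direction_floor_vec[OF along_at_top]])
        (simp add: eventually_along)
    then show ?thesis by (auto simp: carrier_CG[OF T])
  qed
  have sub: "subgroup ?C ?P"
  proof (rule P.subgroupI)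
    show "?C \<subseteq> carrier ?P" by (auto simp: carrier_CG[OF T])
    show "?C \<noteq> {}" using fl by blast
  next
    fix g assume g: "g \<in> ?C"
    have gT: "g \<in> T \<rightarrow>\<^sub>E carrier Zn" using g by (simp add: carrier_CG[OF T])
    have d: "has_direction (along T) (\<lambda>t. t) g (direction (along T) (\<lambda>t. t) g)"
      using g has_direction_direction[OF _ along_neq_bot[OF T]] by (auto simp: carrier_CG[OF T])
    have "has_direction (along T) (\<lambda>t. t) (\<lambda>t\<in>T. inv\<^bsub>Zn\<^esub> (g t)) (inv\<^bsub>Rn\<^esub> direction (along T) (\<lambda>t. t) g)"
      by (rule has_direction_cong[OF has_direction_inv[OF d]])
        (use gT direction_closed in \<open>auto simp: eventually_along\<close>)
    then show "inv\<^bsub>?P\<^esub> g \<in> ?C"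
      using gT by (auto simp: carrier_CG[OF T] Zn.group_axioms)
    fix h assume h: "h \<in> ?C"
    obtain v w where "has_direction (along T) (\<lambda>t. t) g v" "has_direction (along T) (\<lambda>t. t) h w"
      using g h by (auto simp: carrier_CG[OF T])
    then have "has_direction (along T) (\<lambda>t. t) (\<lambda>t\<in>T. g t \<otimes>\<^bsub>Zn\<^esub> h t) (v \<otimes>\<^bsub>Rn\<^esub> w)"
      by (rule has_direction_cong[OF has_direction_mult]) (auto simp: eventually_along)
    then show "g \<otimes>\<^bsub>?P\<^esub> h \<in> ?C"
      using g h by (auto simp: carrier_CG[OF T])
  qed
  have "norm_presentation (?P\<lparr>carrier := ?C\<rparr>) Rn (direction (along T) (\<lambda>t. t)) (real_L1_norm n)
      (CG_norm Zn (int_L1_norm n) T)"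
  proof (rule norm_presentation_directions[OF along_neq_bot[OF T] eventually_along_mem along_at_top sub])
    show "(\<lambda>t\<in>T. floor_vec t v) \<in> ?C" for v by (rule fl)
  qed (use CG_norm_eq[OF T] in \<open>auto simp: carrier_CG[OF T]\<close>)
  moreover have "?P\<lparr>carrier := ?C\<rparr> = CG Zn (int_L1_norm n) T"
    by (simp add: CG_def)
  ultimately show ?thesis by simp
qed

lemma dir_cone_eq:
  assumes "scaling_set T"
  shows "dir_cone Zn (int_L1_norm n) T =
      CG Zn (int_L1_norm n) T Mod norm_presentation.null (CG Zn (int_L1_norm n) T) (CG_norm Zn (int_L1_norm n) T)"
    and "dir_cone_null Zn (int_L1_norm n) T =
      norm_presentation.null (CG Zn (int_L1_norm n) T) (CG_norm Zn (int_L1_norm n) T)"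
proof -
  interpret norm_presentation "CG Zn (int_L1_norm n) T" Rn "direction (along T) (\<lambda>t. t)" "real_L1_norm n"
    "CG_norm Zn (int_L1_norm n) T"
    by (rule norm_presentation_CG[OF assms])
  show "dir_cone_null Zn (int_L1_norm n) T = null"
    by (simp add: dir_cone_null_def null_def)
  then show "dir_cone Zn (int_L1_norm n) T = CG Zn (int_L1_norm n) T Mod null"
    by (simp add: dir_cone_def)
qed

theorem dir_cone_isometric_Rn:
  assumes "scaling_set T"
  shows "\<exists>\<phi>. isometric_iso (dir_cone Zn (int_L1_norm n) T) (dir_cone_norm Zn (int_L1_norm n) T)
    Rn (real_L1_norm n) \<phi>"
  using norm_presentation.isometric_quotient[OF norm_presentation_CG[OF assms]]
  by (auto simp: dir_cone_eq[OF assms] dir_cone_norm_def[abs_def])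

theorem independent_of_scaling_Zn: "independent_of_scaling Zn (int_L1_norm n)"
  unfolding independent_of_scaling_def
proof (intro allI impI)
  fix T T' assume T: "scaling_set T" and T': "scaling_set T'" and sub: "T \<subseteq> T'"
  have le: "along T \<le> along T'"
    using sub by (intro inf_mono) auto
  have dir: "has_direction (along T) (\<lambda>t. t) (restrict g T) (direction (along T') (\<lambda>t. t) g)"
    if "g \<in> carrier (CG Zn (int_L1_norm n) T')" for g
    using that has_direction_direction[OF _ along_neq_bot[OF T']]
    by (intro has_direction_cong[OF has_direction_mono[OF _ le]])
      (auto simp: carrier_CG[OF T'] eventually_along)
  have "isometric_iso (dir_cone Zn (int_L1_norm n) T') (\<lambda>X. the_elem (CG_norm Zn (int_L1_norm n) T' ` X))
      (dir_cone Zn (int_L1_norm n) T) (\<lambda>X. the_elem (CG_norm Zn (int_L1_norm n) T ` X))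
      (\<lambda>X. the_elem ((\<lambda>g. dir_cone_class Zn (int_L1_norm n) T (restrict g T)) ` X))"
    unfolding dir_cone_eq(1)[OF T] dir_cone_eq(1)[OF T'] dir_cone_class_def dir_cone_eq(2)[OF T]
  proof (rule isometric_iso_quotients[OF norm_presentation_CG[OF T'] norm_presentation_CG[OF T]])
    fix g assume g: "g \<in> carrier (CG Zn (int_L1_norm n) T')"
    show "restrict g T \<in> carrier (CG Zn (int_L1_norm n) T)"
      using g dir[OF g] sub by (auto simp: carrier_CG[OF T] carrier_CG[OF T'])
    show "direction (along T) (\<lambda>t. t) (restrict g T) = direction (along T') (\<lambda>t. t) g"
      by (rule direction_eqI[OF dir[OF g] along_neq_bot[OF T] direction_closed])
  qed
  then show "isometric_iso (dir_cone Zn (int_L1_norm n) T') (dir_cone_norm Zn (int_L1_norm n) T')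
      (dir_cone Zn (int_L1_norm n) T) (dir_cone_norm Zn (int_L1_norm n) T)
      (dir_cone_restrict Zn (int_L1_norm n) T)"
    by (simp add: dir_cone_norm_def[abs_def] dir_cone_restrict_def[abs_def])
qed

end

section \<open>The ultrafilter cone of the integer vectors\<close>

text \<open>
  If the complement of a finite set were missing from the ultrafilter, a singleton would
  belong to it, and it would be principal.
\<close>

lemma nonprincipal_ultrafilter_le_sequentially:
  assumes "nonprincipal_ultrafilter \<omega>"
  shows "\<omega> \<le> sequentially"
proof (rule filter_leI)
  have not_single: "eventually (\<lambda>k. k \<noteq> j) \<omega>" for j
  proof (rule ccontr)
    assume "\<not> eventually (\<lambda>k. k \<noteq> j) \<omega>"
    then have j: "eventually (\<lambda>k. k = j) \<omega>"
      using assms unfolding nonprincipal_ultrafilter_def by (metis (mono_tags, lifting) eventually_mono)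
    have "\<omega> = principal {j}"
    proof (rule filter_eq_iff[THEN iffD2], intro allI iffI)
      fix P assume "eventually P \<omega>"
      then have "\<exists>k. P k \<and> k = j"
        using eventually_happens'[OF _ eventually_conj[OF _ j]] assms
        by (auto simp: nonprincipal_ultrafilter_def)
      then show "eventually P (principal {j})" by (simp add: eventually_principal)
    next
      fix P assume "eventually P (principal {j})"
      then show "eventually P \<omega>"
        using j by (auto simp: eventually_principal elim: eventually_mono)
    qed
    then show False using assms by (simp add: nonprincipal_ultrafilter_def)
  qed
  fix P assume "eventually P sequentially"
  then obtain m where m: "\<And>k. m \<le> k \<Longrightarrow> P k" by (auto simp: eventually_sequentially)
  have "eventually (\<lambda>k. \<forall>j\<in>{..<m}. k \<noteq> j) \<omega>"
    using not_single by (intro eventually_ball_finite) auto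
  then show "eventually P \<omega>"
    by eventually_elim (metis m leI lessThan_iff)
qed

text \<open>By compactness there is a cluster point, and along an ultrafilter a cluster point is a limit.\<close>

lemma ultrafilter_bounded_convergent:
  fixes f :: "nat \<Rightarrow> real"
  assumes \<omega>: "nonprincipal_ultrafilter \<omega>" and bound: "eventually (\<lambda>k. \<bar>f k\<bar> \<le> B) \<omega>"
  obtains l where "(f \<longlongrightarrow> l) \<omega>"
proof -
  have "filtermap f \<omega> \<noteq> bot"
    using \<omega> by (simp add: filtermap_bot_iff nonprincipal_ultrafilter_def)
  moreover have "eventually (\<lambda>x. x \<in> {- B..B}) (filtermap f \<omega>)"
    unfolding eventually_filtermap using bound by eventually_elim auto
  moreover have "compact {- B..B}" by (rule compact_Icc)
  ultimately obtain l where l: "inf (nhds l) (filtermap f \<omega>) \<noteq> bot"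
    unfolding compact_filter by blast
  have "(f \<longlongrightarrow> l) \<omega>"
  proof (rule topological_tendstoI)
    fix S assume S: "open S" "l \<in> S"
    show "eventually (\<lambda>k. f k \<in> S) \<omega>"
    proof (rule ccontr)
      assume "\<not> eventually (\<lambda>k. f k \<in> S) \<omega>"
      then have "eventually (\<lambda>k. f k \<notin> S) \<omega>"
        using \<omega> by (auto simp: nonprincipal_ultrafilter_def)
      then have "eventually (\<lambda>x. x \<notin> S) (filtermap f \<omega>)"
        by (simp add: eventually_filtermap)
      then have "eventually (\<lambda>_. False) (inf (nhds l) (filtermap f \<omega>))"
        using eventually_nhds_in_open[OF S] unfolding eventually_inf
        by (intro exI[of _ "\<lambda>x. x \<in> S"] exI[of _ "\<lambda>x. x \<notin> S"]) simp
      then show False using l by simp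
    qed
  qed
  then show ?thesis using that by blast
qed

lemma limsup_finite_iff:
  fixes f :: "nat \<Rightarrow> real"
  shows "limsup (\<lambda>k. ereal (f k)) < \<infinity> \<longleftrightarrow> (\<exists>B. eventually (\<lambda>k. f k \<le> B) sequentially)"
proof
  assume "limsup (\<lambda>k. ereal (f k)) < \<infinity>"
  then obtain B where "limsup (\<lambda>k. ereal (f k)) < ereal B"
    using ereal_dense2 by blast
  then have "eventually (\<lambda>k. ereal (f k) < ereal B) sequentially"
    by (rule Limsup_lessD)
  then show "\<exists>B. eventually (\<lambda>k. f k \<le> B) sequentially"
    by (intro exI[of _ B]) (auto elim: eventually_mono)
next
  assume "\<exists>B. eventually (\<lambda>k. f k \<le> B) sequentially"
  then obtain B where "eventually (\<lambda>k. f k \<le> B) sequentially" by blast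
  then have "limsup (\<lambda>k. ereal (f k)) \<le> ereal B"
    by (intro Limsup_bounded) (auto elim: eventually_mono)
  then show "limsup (\<lambda>k. ereal (f k)) < \<infinity>"
    by (rule order_le_less_trans) simp
qed

locale int_vectors_ucone = int_vectors +
  fixes \<omega> :: "nat filter" and d :: "nat \<Rightarrow> real"
  assumes \<omega>: "nonprincipal_ultrafilter \<omega>" and d: "scaling_sequence d"
begin

abbreviation U :: "(nat \<Rightarrow> nat \<Rightarrow> int) monoid" where "U \<equiv> ucone_seqs Zn (int_L1_norm n) d"

definition ulim_norm :: "(nat \<Rightarrow> nat \<Rightarrow> int) \<Rightarrow> real" where
  "ulim_norm g = Lim \<omega> (\<lambda>k. int_L1_norm n (g k) / d k)"

lemma \<omega>_neq_bot: "\<omega> \<noteq> bot"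
  using \<omega> by (simp add: nonprincipal_ultrafilter_def)

lemma d_pos: "0 < d k"
  using d by (simp add: scaling_sequence_def)

lemma d_at_top: "filterlim d at_top sequentially"
  using d by (simp add: scaling_sequence_def)

lemma d_at_top_\<omega>: "filterlim d at_top \<omega>"
  using filterlim_mono[OF d_at_top order_refl nonprincipal_ultrafilter_le_sequentially[OF \<omega>]] .

lemma carrier_U: "carrier U = {g. (\<forall>k. g k \<in> carrier Zn) \<and>
    (\<exists>B. eventually (\<lambda>k. int_L1_norm n (g k) / d k \<le> B) sequentially)}"
  unfolding ucone_seqs_def limsup_finite_iff by (simp add: image_subset_iff)

lemma U_of_direction:
  assumes "\<And>k. g k \<in> carrier Zn" and "has_direction sequentially d g v"
  shows "g \<in> carrier U"
proof -
  have "((\<lambda>k. int_L1_norm n (g k) / d k) \<longlongrightarrow> real_L1_norm n v) sequentially"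
    using assms(2) by (rule has_direction_norm) (simp add: d_pos)
  then have "eventually (\<lambda>k. int_L1_norm n (g k) / d k < real_L1_norm n v + 1) sequentially"
    by (rule order_tendstoD) simp
  then show ?thesis
    using assms(1) by (auto simp: carrier_U intro!: exI[of _ "real_L1_norm n v + 1"] elim: eventually_mono)
qed

lemma U_direction:
  assumes "g \<in> carrier U"
  shows "has_direction \<omega> d g (direction \<omega> d g)"
proof -
  obtain B where "eventually (\<lambda>k. int_L1_norm n (g k) / d k \<le> B) sequentially"
    using assms by (auto simp: carrier_U)
  then have B: "eventually (\<lambda>k. int_L1_norm n (g k) / d k \<le> B) \<omega>"
    using nonprincipal_ultrafilter_le_sequentially[OF \<omega>] by (simp add: le_filter_def)
  have "\<exists>l. ((\<lambda>k. of_int (g k i) / d k) \<longlongrightarrow> l) \<omega>" if "i < n" for i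
  proof -
    have "eventually (\<lambda>k. \<bar>of_int (g k i) / d k\<bar> \<le> B) \<omega>"
      using B
    proof eventually_elim
      case (elim k)
      have "\<bar>of_int (g k i)\<bar> \<le> int_L1_norm n (g k)"
        unfolding int_L1_norm_def using that by (intro member_le_sum) auto
      then have "\<bar>of_int (g k i)\<bar> / d k \<le> int_L1_norm n (g k) / d k"
        using d_pos[of k] by (intro divide_right_mono) auto
      then show ?case using elim d_pos[of k] by (simp add: abs_divide)
    qed
    then show ?thesis using ultrafilter_bounded_convergent[OF \<omega>] by metis
  qed
  then have "\<exists>v. has_direction \<omega> d g v"
    unfolding has_direction_def by metis
  then show ?thesis using has_direction_direction \<omega>_neq_bot by blast
qed

lemma floor_vec_U: "(\<lambda>k. floor_vec (d k) v) \<in> carrier U"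
  by (rule U_of_direction[OF floor_vec_closed has_direction_floor_vec[OF d_at_top]])

lemma ulim_norm_eq: "g \<in> carrier U \<Longrightarrow> ulim_norm g = real_L1_norm n (direction \<omega> d g)"
  unfolding ulim_norm_def
  by (intro tendsto_Lim \<omega>_neq_bot has_direction_norm U_direction) (simp_all add: d_pos)

lemma subgroup_U: "subgroup (carrier U) (product_group UNIV (\<lambda>_. Zn))"
proof -
  interpret P: group "product_group UNIV (\<lambda>_::nat. Zn)" by (simp add: Zn.group_axioms)
  show ?thesis
  proof (rule P.subgroupI)
    show "carrier U \<subseteq> carrier (product_group UNIV (\<lambda>_. Zn))" by (auto simp: carrier_U)
    show "carrier U \<noteq> {}" using floor_vec_U by blast
  next
    fix g assume g: "g \<in> carrier U"
    then have gk: "g k \<in> carrier Zn" for k by (simp add: carrier_U)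
    then have "inv\<^bsub>product_group UNIV (\<lambda>_. Zn)\<^esub> g = (\<lambda>k. inv\<^bsub>Zn\<^esub> (g k))"
      using inv_product_group[of g UNIV "\<lambda>_. Zn"] by (simp add: Zn.group_axioms restrict_UNIV PiE_UNIV_domain)
    then show "inv\<^bsub>product_group UNIV (\<lambda>_. Zn)\<^esub> g \<in> carrier U"
      using g by (simp add: carrier_U Zn.norm_inv)
    fix h assume h: "h \<in> carrier U"
    then have hk: "h k \<in> carrier Zn" for k by (simp add: carrier_U)
    obtain B B' where "eventually (\<lambda>k. int_L1_norm n (g k) / d k \<le> B) sequentially"
      "eventually (\<lambda>k. int_L1_norm n (h k) / d k \<le> B') sequentially"
      using g h by (auto simp: carrier_U)
    then have "eventually (\<lambda>k. int_L1_norm n (g k \<otimes>\<^bsub>Zn\<^esub> h k) / d k \<le> B + B') sequentially"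
    proof eventually_elim
      case (elim k)
      have "int_L1_norm n (g k \<otimes>\<^bsub>Zn\<^esub> h k) / d k \<le> (int_L1_norm n (g k) + int_L1_norm n (h k)) / d k"
        using Zn.norm_mult[OF gk[of k] hk[of k]] d_pos[of k] by (simp add: divide_right_mono)
      then show ?case using elim by (simp add: add_divide_distrib)
    qed
    then show "g \<otimes>\<^bsub>product_group UNIV (\<lambda>_. Zn)\<^esub> h \<in> carrier U"
      using gk hk unfolding carrier_U by (auto simp: restrict_UNIV)
  qed
qed

theorem norm_presentation_U: "norm_presentation U Rn (direction \<omega> d) (real_L1_norm n) ulim_norm"
proof -
  have "norm_presentation (product_group UNIV (\<lambda>_. Zn)\<lparr>carrier := carrier U\<rparr>) Rn (direction \<omega> d)
      (real_L1_norm n) ulim_norm"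
  proof (rule norm_presentation_directions[OF \<omega>_neq_bot _ d_at_top_\<omega> subgroup_U])
    show "\<exists>v. has_direction \<omega> d g v" if "g \<in> carrier U" for g
      using U_direction[OF that] by blast
  qed (simp_all add: ulim_norm_eq floor_vec_U restrict_UNIV)
  moreover have "product_group UNIV (\<lambda>_. Zn)\<lparr>carrier := carrier U\<rparr> = U"
    by (simp add: ucone_seqs_def)
  ultimately show ?thesis by simp
qed

sublocale U: norm_presentation U Rn "direction \<omega> d" "real_L1_norm n" ulim_norm
  by (rule norm_presentation_U)

lemma mult_U: "g \<otimes>\<^bsub>U\<^esub> h = (\<lambda>k. g k \<otimes>\<^bsub>Zn\<^esub> h k)"
  by (simp add: ucone_seqs_def restrict_UNIV)

lemma one_U: "\<one>\<^bsub>U\<^esub> = (\<lambda>k. \<one>\<^bsub>Zn\<^esub>)"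
  by (simp add: ucone_seqs_def restrict_UNIV)

lemma inv_U: "g \<in> carrier U \<Longrightarrow> inv\<^bsub>U\<^esub> g = (\<lambda>k. inv\<^bsub>Zn\<^esub> (g k))"
proof (rule U.G.inv_equality)
  assume g: "g \<in> carrier U"
  then show "(\<lambda>k. inv\<^bsub>Zn\<^esub> (g k)) \<in> carrier U"
    by (auto simp: carrier_U Zn.norm_inv)
  show "(\<lambda>k. inv\<^bsub>Zn\<^esub> (g k)) \<otimes>\<^bsub>U\<^esub> g = \<one>\<^bsub>U\<^esub>"
    using g by (simp add: mult_U one_U carrier_U)
qed

text \<open>
  The quotient of two sequences has the difference of their directions as its direction, and
  its rescaled norm tends to the length of that difference.
\<close>

lemma ucone_rel_eq:
  "ucone_rel Zn (int_L1_norm n) \<omega> d =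
    {(g, h). g \<in> carrier U \<and> h \<in> carrier U \<and> direction \<omega> d g = direction \<omega> d h}"
proof -
  have "((\<lambda>k. int_L1_norm n (inv\<^bsub>Zn\<^esub> (g k) \<otimes>\<^bsub>Zn\<^esub> h k) / d k) \<longlongrightarrow> 0) \<omega> \<longleftrightarrow>
      direction \<omega> d g = direction \<omega> d h" if g: "g \<in> carrier U" and h: "h \<in> carrier U" for g h
  proof -
    let ?x = "inv\<^bsub>U\<^esub> g \<otimes>\<^bsub>U\<^esub> h"
    have "has_direction \<omega> d ?x (direction \<omega> d ?x)"
      using g h by (intro U_direction) simp
    then have lim: "((\<lambda>k. int_L1_norm n (?x k) / d k) \<longlongrightarrow> real_L1_norm n (direction \<omega> d ?x)) \<omega>"
      by (rule has_direction_norm) (simp add: d_pos)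
    have "((\<lambda>k. int_L1_norm n (inv\<^bsub>Zn\<^esub> (g k) \<otimes>\<^bsub>Zn\<^esub> h k) / d k) \<longlongrightarrow> 0) \<omega> \<longleftrightarrow>
        ((\<lambda>k. int_L1_norm n (?x k) / d k) \<longlongrightarrow> 0) \<omega>"
      using g by (simp add: inv_U mult_U)
    also have "\<dots> \<longleftrightarrow> real_L1_norm n (direction \<omega> d ?x) = 0"
    proof
      show "real_L1_norm n (direction \<omega> d ?x) = 0"
        if "((\<lambda>k. int_L1_norm n (?x k) / d k) \<longlongrightarrow> 0) \<omega>"
        by (rule tendsto_unique[OF \<omega>_neq_bot lim that])
      show "((\<lambda>k. int_L1_norm n (?x k) / d k) \<longlongrightarrow> 0) \<omega>"
        if "real_L1_norm n (direction \<omega> d ?x) = 0"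
        using lim unfolding that .
    qed
    also have "\<dots> \<longleftrightarrow> direction \<omega> d ?x = \<one>\<^bsub>Rn\<^esub>"
      by (rule Rn.norm_eq_0_iff[OF direction_closed])
    also have "\<dots> \<longleftrightarrow> direction \<omega> d h = direction \<omega> d g"
      using g h Rn.inv_solve_left'[OF Rn.one_closed direction_closed direction_closed, of \<omega> d g \<omega> d h]
      by (simp add: direction_closed)
    also have "\<dots> \<longleftrightarrow> direction \<omega> d g = direction \<omega> d h" by (rule eq_commute)
    finally show ?thesis .
  qed
  then show ?thesis by (auto simp: ucone_rel_def)
qed

lemma ucone_class_eq:
  "g \<in> carrier U \<Longrightarrow> ucone_class Zn (int_L1_norm n) \<omega> d g = U.null #>\<^bsub>U\<^esub> g"
  by (auto simp: ucone_class_def ucone_rel_eq U.coset_eq_fibre)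

lemma ucone_eq_quotient: "ucone Zn (int_L1_norm n) \<omega> d = U Mod U.null"
proof -
  interpret N: normal U.null U by (rule U.null_normal)
  have "carrier U // ucone_rel Zn (int_L1_norm n) \<omega> d = carrier (U Mod U.null)"
    using ucone_class_eq by (auto simp: quotient_def U.carrier_quotient ucone_class_def)
  moreover have "ucone_class Zn (int_L1_norm n) \<omega> d (\<lambda>k. \<one>\<^bsub>Zn\<^esub>) = U.null"
    using ucone_class_eq[OF U.G.one_closed] U.G.coset_mult_one[OF N.subset] by (simp add: one_U)
  ultimately show ?thesis
    by (simp add: ucone_def FactGroup_def)
qed

theorem dir_cone_to_ucone_isometric:
  "isometric_iso (dir_cone Zn (int_L1_norm n) {0<..}) (dir_cone_norm Zn (int_L1_norm n) {0<..})
     (ucone Zn (int_L1_norm n) \<omega> d) (ucone_norm Zn (int_L1_norm n) \<omega> d)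
     (dir_cone_to_ucone Zn (int_L1_norm n) \<omega> d)"
proof -
  let ?C = "CG Zn (int_L1_norm n) {0<..}" and ?r = "\<lambda>g k. g (d k)"
  have "\<exists>x\<in>{0<..}. a < x" for a :: real
    by (rule bexI[of _ "max 1 (a + 1)"]) auto
  then have T: "scaling_set {0<..}"
    by (auto simp: scaling_set_def bounded_real not_le)
  interpret C: norm_presentation ?C Rn "direction (along {0<..}) (\<lambda>t. t)" "real_L1_norm n"
    "CG_norm Zn (int_L1_norm n) {0<..}"
    by (rule norm_presentation_CG[OF T])
  have d_along: "filterlim d (along {0<..}) sequentially"
    using d_at_top by (simp add: filterlim_inf filterlim_principal d_pos)
  have r: "?r g \<in> carrier U" "direction \<omega> d (?r g) = direction (along {0<..}) (\<lambda>t. t) g"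
    if g: "g \<in> carrier ?C" for g
  proof -
    have "has_direction (along {0<..}) (\<lambda>t. t) g (direction (along {0<..}) (\<lambda>t. t) g)"
      using g has_direction_direction[OF _ along_neq_bot[OF T]] by (auto simp: carrier_CG[OF T])
    then have dir: "has_direction sequentially d (?r g) (direction (along {0<..}) (\<lambda>t. t) g)"
      using has_direction_compose[OF _ d_along] by blast
    moreover have "?r g k \<in> carrier Zn" for k
      using g d_pos by (auto simp: carrier_CG[OF T])
    ultimately show "?r g \<in> carrier U" by (intro U_of_direction)
    show "direction \<omega> d (?r g) = direction (along {0<..}) (\<lambda>t. t) g"
      using has_direction_mono[OF dir nonprincipal_ultrafilter_le_sequentially[OF \<omega>]]
      by (rule direction_eqI[OF _ \<omega>_neq_bot direction_closed])
  qed
  let ?q = "\<lambda>X. the_elem ((\<lambda>g. U.null #>\<^bsub>U\<^esub> ?r g) ` X)"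
  have iso: "isometric_iso (dir_cone Zn (int_L1_norm n) {0<..}) (dir_cone_norm Zn (int_L1_norm n) {0<..})
      (ucone Zn (int_L1_norm n) \<omega> d) (ucone_norm Zn (int_L1_norm n) \<omega> d) ?q"
    using isometric_iso_quotients[OF norm_presentation_CG[OF T] norm_presentation_U r]
    by (simp add: dir_cone_eq(1)[OF T] ucone_eq_quotient dir_cone_norm_def[abs_def]
        ucone_norm_def[abs_def] ulim_norm_def[abs_def])
  \<comment> \<open>Classes are cosets only for sequences of at most linear growth; these are the only
    ones that representatives of elements of the directional cone give rise to.\<close>
  have "?q X = dir_cone_to_ucone Zn (int_L1_norm n) \<omega> d X"
    if "X \<in> carrier (dir_cone Zn (int_L1_norm n) {0<..})" for X
  proof -
    have "X \<subseteq> carrier ?C"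
      using that C.coset_memD(1) by (auto simp: dir_cone_eq(1)[OF T] C.carrier_quotient)
    then have "(\<lambda>g. U.null #>\<^bsub>U\<^esub> ?r g) ` X = (\<lambda>g. ucone_class Zn (int_L1_norm n) \<omega> d (?r g)) ` X"
      using r(1) ucone_class_eq by (intro image_cong) auto
    then show ?thesis by (simp add: dir_cone_to_ucone_def)
  qed
  then show ?thesis
    using C.group_quotient by (intro isometric_iso_cong[OF _ iso]) (simp add: dir_cone_eq(1)[OF T])
qed

end

theorem proposition10p2:
  fixes n :: nat
  shows "(\<forall>T. scaling_set T \<longrightarrow>
           (\<exists>\<phi>. isometric_iso
                  (dir_cone (int_vec_group n) (int_L1_norm n) T)
                  (dir_cone_norm (int_vec_group n) (int_L1_norm n) T)
                  (real_vec_group n) (real_L1_norm n) \<phi>)) \<and>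
         independent_of_scaling (int_vec_group n) (int_L1_norm n) \<and>
         (\<forall>\<omega> d. nonprincipal_ultrafilter \<omega> \<longrightarrow> scaling_sequence d \<longrightarrow>
           isometric_iso
             (dir_cone (int_vec_group n) (int_L1_norm n) {0<..})
             (dir_cone_norm (int_vec_group n) (int_L1_norm n) {0<..})
             (ucone (int_vec_group n) (int_L1_norm n) \<omega> d)
             (ucone_norm (int_vec_group n) (int_L1_norm n) \<omega> d)
             (dir_cone_to_ucone (int_vec_group n) (int_L1_norm n) \<omega> d))"
proof (intro conjI allI impI)
  show "\<exists>\<phi>. isometric_iso (dir_cone (int_vec_group n) (int_L1_norm n) T)
      (dir_cone_norm (int_vec_group n) (int_L1_norm n) T) (real_vec_group n) (real_L1_norm n) \<phi>"
    if "scaling_set T" for T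
    by (rule int_vectors.dir_cone_isometric_Rn[OF that])
  show "independent_of_scaling (int_vec_group n) (int_L1_norm n)"
    by (rule int_vectors.independent_of_scaling_Zn)
  fix \<omega> d assume "nonprincipal_ultrafilter \<omega>" "scaling_sequence d"
  then interpret int_vectors_ucone n \<omega> d by unfold_locales
  show "isometric_iso (dir_cone (int_vec_group n) (int_L1_norm n) {0<..})
      (dir_cone_norm (int_vec_group n) (int_L1_norm n) {0<..}) (ucone (int_vec_group n) (int_L1_norm n) \<omega> d)
      (ucone_norm (int_vec_group n) (int_L1_norm n) \<omega> d)
      (dir_cone_to_ucone (int_vec_group n) (int_L1_norm n) \<omega> d)"
    by (rule dir_cone_to_ucone_isometric)
qed

end
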